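(* For each positive integer $k$ there exist a metric space $X$ with a basepoint $e\in X$ and a scaling factor $\alpha=(\alpha_n)_{n\in\mathbb{N}}$ such that for every non-principal ultrafilter $\mu$ on $\mathbb{N}$ and all distinct ordinals $\lambda_1,\lambda_2<\omega\cdot k$, the (transfinitely) iterated cones $\operatorname{Cone}^{\lambda_1}_\mu(X,e,\alpha)$ and $\operatorname{Cone}^{\lambda_2}_\mu(X,e,\alpha)$ are not homeomorphic.
   Context: A scaling factor is a sequence $\alpha=(\alpha_n)_{n\in\mathbb{N}}$ of positive real numbers diverging to $+\infty$. For an ultrafilter $\mu$ on $\mathbb{N}$ and a sequence $(x_n)$ in $[0,+\infty]$, $\mu\text{-}\lim x_n$ is the unique $a\in[0,+\infty]$ such that for every neighborhood $U$ of $a$ one has $\{n: x_n\in U\}\in\mu$. Ultralimit of metric spaces: for metric spaces $(X_n,d_n)$ with basepoints $x_n\in X_n$ ($n\in\mathbb{N}$), $\mu\text{-}\lim (X_n,(x_n))$ is the quotient of $\{(y_n)\in\prod X_n:\mu\text{-}\lim d_n(x_n,y_n)<\infty\}$ by $(y_n)\approx(z_n)\iff\mu\text{-}\lim d_n(y_n,z_n)=0$, with metric $\mu\text{-}\lim d_n(y_n,z_n)$ and basepoint the class $[x_n]$. For a metric space $(X,d)$ and $e\in X$, the asymptotic cone $\operatorname{Cone}_\mu(X,e,\alpha)$ is the ultralimit of the spaces $(X,d/\alpha_n)$ with constant basepoint $e$. Transfinite iterated cones: for ordinals $\lambda=\omega\cdot k+n$ with $k,n\in\mathbb{N}$, define the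 pointed spaces $\operatorname{Cone}^\lambda_\mu(X,e,\alpha)$ recursively by $\operatorname{Cone}^0_\mu(X,e,\alpha)=X$ with basepoint $e$; $\operatorname{Cone}^{\lambda+1}_\mu(X,e,\alpha)=\operatorname{Cone}_\mu(\operatorname{Cone}^\lambda_\mu(X,e,\alpha),\hat e,\alpha)$, where $\hat e$ is the basepoint of $\operatorname{Cone}^\lambda_\mu(X,e,\alpha)$ and the new basepoint is the class of the constant sequence $\hat e$; and $\operatorname{Cone}^{\omega\cdot(k+1)}_\mu(X,e,\alpha)=\mu\text{-}\lim_n \operatorname{Cone}^{\omega\cdot k+n}_\mu(X,e,\alpha)$, the ultralimit taken with respect to the basepoints of these spaces. *)

theory Defs
  imports "HOL-Analysis.Analysis"
begin

section \<open>Ultrafilters and ultralimits of pointed metric spaces\<close>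

text \<open>Ultrafilters are rendered as library filters: \<^prop>\<open>eventually P \<mu>\<close> says that
  \<^term>\<open>{n. P n}\<close> belongs to the ultrafilter.\<close>

definition ultrafilter :: "'i filter \<Rightarrow> bool" where
  "ultrafilter \<mu> \<longleftrightarrow> \<mu> \<noteq> bot \<and> (\<forall>P. eventually P \<mu> \<or> eventually (\<lambda>n. \<not> P n) \<mu>)"

definition nonprincipal :: "'i filter \<Rightarrow> bool" where
  "nonprincipal \<mu> \<longleftrightarrow> (\<forall>m. \<not> eventually (\<lambda>n. n = m) \<mu>)"

definition scaling_factor :: "(nat \<Rightarrow> real) \<Rightarrow> bool" where
  "scaling_factor \<alpha> \<longleftrightarrow> (\<forall>n. 0 < \<alpha> n) \<and> filterlim \<alpha> at_top sequentially"

type_synonym 'a pointed_metric = "'a metric \<times> 'a"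

abbreviation pspace :: "'a pointed_metric \<Rightarrow> 'a metric" where "pspace \<equiv> fst"
abbreviation basept :: "'a pointed_metric \<Rightarrow> 'a" where "basept \<equiv> snd"

definition pointed :: "'a pointed_metric \<Rightarrow> bool" where
  "pointed P \<longleftrightarrow> basept P \<in> mspace (pspace P)"

definition ulim_dist :: "nat filter \<Rightarrow> (nat \<Rightarrow> 'a pointed_metric) \<Rightarrow> (nat \<Rightarrow> 'a) \<Rightarrow> (nat \<Rightarrow> 'a) \<Rightarrow> ennreal" where
  "ulim_dist \<mu> P y z = Lim \<mu> (\<lambda>n. ennreal (mdist (pspace (P n)) (y n) (z n)))"

definition ulim_seqs :: "nat filter \<Rightarrow> (nat \<Rightarrow> 'a pointed_metric) \<Rightarrow> (nat \<Rightarrow> 'a) set" where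
  "ulim_seqs \<mu> P = {y. (\<forall>n. y n \<in> mspace (pspace (P n))) \<and> ulim_dist \<mu> P (\<lambda>n. basept (P n)) y < \<infinity>}"

definition ulim_rel :: "nat filter \<Rightarrow> (nat \<Rightarrow> 'a pointed_metric) \<Rightarrow> ((nat \<Rightarrow> 'a) \<times> (nat \<Rightarrow> 'a)) set" where
  "ulim_rel \<mu> P = {(y, z). y \<in> ulim_seqs \<mu> P \<and> z \<in> ulim_seqs \<mu> P \<and> ulim_dist \<mu> P y z = 0}"

text \<open>The distance of two classes is read off from chosen representatives;
  independence of the choice is \<open>mdist_ultralimit\<close> below.\<close>

definition ultralimit :: "nat filter \<Rightarrow> (nat \<Rightarrow> 'a pointed_metric) \<Rightarrow> (nat \<Rightarrow> 'a) set pointed_metric" where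
  "ultralimit \<mu> P =
     (metric (ulim_seqs \<mu> P // ulim_rel \<mu> P,
              \<lambda>C D. enn2real (ulim_dist \<mu> P (SOME y. y \<in> C) (SOME z. z \<in> D))),
      ulim_rel \<mu> P `` {\<lambda>n. basept (P n)})"

definition rescale :: "real \<Rightarrow> 'a metric \<Rightarrow> 'a metric" where
  "rescale c X = metric (mspace X, \<lambda>x y. mdist X x y / c)"

definition asymp_cone :: "nat filter \<Rightarrow> (nat \<Rightarrow> real) \<Rightarrow> 'a pointed_metric \<Rightarrow> (nat \<Rightarrow> 'a) set pointed_metric" where
  "asymp_cone \<mu> \<alpha> P = ultralimit \<mu> (\<lambda>n. (rescale (\<alpha> n) (pspace P), basept P))"


section \<open>Iterated cones\<close>

text \<open>The points of an ultralimit of spaces over \<open>'a\<close> have type \<open>(nat \<Rightarrow> 'a) set\<close>. So that all the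
  iterated cones live in one type, they are transported isometrically into the following type:
  a point of the initial space is tagged by \<^term>\<open>Point\<close>, and an equivalence class is encoded
  by one chosen representative sequence.\<close>

datatype 'a cone_point = Point 'a | Rep "nat \<Rightarrow> 'a cone_point"

definition transport :: "('a \<Rightarrow> 'b) \<Rightarrow> 'a pointed_metric \<Rightarrow> 'b pointed_metric" where
  "transport f P =
     (metric (f ` mspace (pspace P),
              \<lambda>u v. mdist (pspace P) (inv_into (mspace (pspace P)) f u) (inv_into (mspace (pspace P)) f v)),
      f (basept P))"

definition encode_class :: "(nat \<Rightarrow> 'a cone_point) set \<Rightarrow> 'a cone_point" where
  "encode_class C = Rep (SOME y. y \<in> C)"

text \<open>\<open>iter_cone \<mu> \<alpha> P k n\<close> is the iterated cone with index the ordinal \<open>\<omega> \<cdot> k + n\<close>.\<close>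

fun iter_cone :: "nat filter \<Rightarrow> (nat \<Rightarrow> real) \<Rightarrow> 'a pointed_metric \<Rightarrow> nat \<Rightarrow> nat \<Rightarrow> 'a cone_point pointed_metric" where
  "iter_cone \<mu> \<alpha> P 0 0 = transport Point P"
| "iter_cone \<mu> \<alpha> P k (Suc n) = transport encode_class (asymp_cone \<mu> \<alpha> (iter_cone \<mu> \<alpha> P k n))"
| "iter_cone \<mu> \<alpha> P (Suc k) 0 = transport encode_class (ultralimit \<mu> (\<lambda>n. iter_cone \<mu> \<alpha> P k n))"

text \<open>The ordinals below \<open>\<omega>\<^sup>2\<close>: the pair \<open>(k, n)\<close> stands for \<open>\<omega> \<cdot> k + n\<close> (Cantor normal form),
  and their order is the lexicographic one.\<close>

type_synonym small_ordinal = "nat \<times> nat"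

definition omega_times :: "nat \<Rightarrow> small_ordinal" where
  "omega_times k = (k, 0)"

definition ord_less :: "small_ordinal \<Rightarrow> small_ordinal \<Rightarrow> bool" where
  "ord_less \<xi> \<eta> \<longleftrightarrow> (\<xi>, \<eta>) \<in> less_than <*lex*> less_than"

definition Cone :: "nat filter \<Rightarrow> small_ordinal \<Rightarrow> 'a metric \<Rightarrow> 'a \<Rightarrow> (nat \<Rightarrow> real) \<Rightarrow> 'a cone_point metric" where
  "Cone \<mu> \<xi> X e \<alpha> = pspace (iter_cone \<mu> \<alpha> (X, e) (fst \<xi>) (snd \<xi>))"


section \<open>Well-definedness\<close>

text \<open>\<^term>\<open>metric (M, d)\<close> is only meaningful when \<^prop>\<open>Metric_space M d\<close> holds; this is
  checked here for each of the constructions above.\<close>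

lemma Metric_space_rescale:
  assumes "0 < c"
  shows "Metric_space (mspace X) (\<lambda>x y. mdist X x y / c)"
proof
  fix x y z assume "x \<in> mspace X" "y \<in> mspace X" "z \<in> mspace X"
  then show "mdist X x z / c \<le> mdist X x y / c + mdist X y z / c"
    using mdist_triangle[of x X y z] assms by (simp add: divide_right_mono flip: add_divide_distrib)
qed (use assms in \<open>auto simp: mdist_commute\<close>)

lemma mspace_rescale [simp]: "0 < c \<Longrightarrow> mspace (rescale c X) = mspace X"
  and mdist_rescale [simp]: "0 < c \<Longrightarrow> mdist (rescale c X) x y = mdist X x y / c"
  using Metric_space_rescale[of c X]
  by (simp_all add: rescale_def Metric_space.mspace_metric Metric_space.mdist_metric)

lemma Metric_space_transport:
  assumes "inj_on f (mspace X)"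
  shows "Metric_space (f ` mspace X)
           (\<lambda>u v. mdist X (inv_into (mspace X) f u) (inv_into (mspace X) f v))"
  by unfold_locales (use assms in \<open>auto simp: mdist_commute mdist_triangle inj_on_eq_iff\<close>)

lemma transport_simps:
  assumes "inj_on f (mspace (pspace P))"
  shows mspace_transport: "mspace (pspace (transport f P)) = f ` mspace (pspace P)"
    and mdist_transport: "x \<in> mspace (pspace P) \<Longrightarrow> y \<in> mspace (pspace P) \<Longrightarrow>
           mdist (pspace (transport f P)) (f x) (f y) = mdist (pspace P) x y"
    and basept_transport: "basept (transport f P) = f (basept P)"
  using Metric_space_transport[OF assms] assms
  by (simp_all add: transport_def Metric_space.mspace_metric Metric_space.mdist_metric)

lemma ultrafilter_tendsto_Lim:
  fixes x :: "'i \<Rightarrow> ennreal"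
  assumes "ultrafilter \<mu>"
  shows "(x \<longlongrightarrow> Lim \<mu> x) \<mu>"
proof -
  have nb: "filtermap x \<mu> \<noteq> bot"
    using assms by (simp add: ultrafilter_def filtermap_bot_iff)
  obtain l where l: "inf (nhds l) (filtermap x \<mu>) \<noteq> bot"
    using compact_UNIV[where 'a=ennreal] nb unfolding compact_filter by auto
  have "(x \<longlongrightarrow> l) \<mu>"
  proof (rule topological_tendstoI, rule ccontr)
    fix U assume U: "open U" "l \<in> U" and "\<not> eventually (\<lambda>n. x n \<in> U) \<mu>"
    then have "eventually (\<lambda>n. x n \<notin> U) \<mu>"
      using assms unfolding ultrafilter_def by blast
    then have 1: "eventually (\<lambda>y. y \<notin> U) (filtermap x \<mu>)" by (simp add: eventually_filtermap)
    have 2: "eventually (\<lambda>y. y \<in> U) (nhds l)" using U by (rule eventually_nhds_in_open)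
    have "eventually (\<lambda>_. False) (inf (nhds l) (filtermap x \<mu>))"
      unfolding eventually_inf using 1 2 by blast
    then show False using l by (simp add: trivial_limit_def)
  qed
  then show ?thesis
    using tendsto_Lim[of \<mu> x l] assms by (simp add: ultrafilter_def)
qed

context
  fixes \<mu> :: "nat filter" and P :: "nat \<Rightarrow> 'a pointed_metric"
  assumes \<mu>: "ultrafilter \<mu>" and P: "\<And>n. pointed (P n)"
begin

lemma ulim_dist_tendsto:
  "((\<lambda>n. ennreal (mdist (pspace (P n)) (y n) (z n))) \<longlongrightarrow> ulim_dist \<mu> P y z) \<mu>"
  unfolding ulim_dist_def by (rule ultrafilter_tendsto_Lim[OF \<mu>])

lemma ulim_dist_commute: "ulim_dist \<mu> P y z = ulim_dist \<mu> P z y"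
  unfolding ulim_dist_def by (simp add: mdist_commute)

lemma ulim_dist_triangle:
  assumes "\<And>n. x n \<in> mspace (pspace (P n))" "\<And>n. y n \<in> mspace (pspace (P n))"
    "\<And>n. z n \<in> mspace (pspace (P n))"
  shows "ulim_dist \<mu> P x z \<le> ulim_dist \<mu> P x y + ulim_dist \<mu> P y z"
proof (rule tendsto_le[OF _ tendsto_add[OF ulim_dist_tendsto ulim_dist_tendsto] ulim_dist_tendsto])
  show "\<mu> \<noteq> bot" using \<mu> by (simp add: ultrafilter_def)
  show "eventually (\<lambda>n. ennreal (mdist (pspace (P n)) (x n) (z n))
      \<le> ennreal (mdist (pspace (P n)) (x n) (y n)) + ennreal (mdist (pspace (P n)) (y n) (z n))) \<mu>"
    using assms by (intro always_eventually allI) (simp add: mdist_triangle flip: ennreal_plus)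
qed

lemma ulim_dist_refl:
  assumes "\<And>n. y n \<in> mspace (pspace (P n))"
  shows "ulim_dist \<mu> P y y = 0"
proof -
  have "mdist (pspace (P n)) (y n) (y n) = 0" for n
    using assms by simp
  then show ?thesis
    using \<mu> unfolding ulim_dist_def by (simp add: tendsto_Lim ultrafilter_def)
qed

lemma ulim_dist_finite:
  assumes "y \<in> ulim_seqs \<mu> P" "z \<in> ulim_seqs \<mu> P"
  shows "ulim_dist \<mu> P y z < \<infinity>"
proof -
  have "ulim_dist \<mu> P y z \<le> ulim_dist \<mu> P y (\<lambda>n. basept (P n)) + ulim_dist \<mu> P (\<lambda>n. basept (P n)) z"
    using assms P by (intro ulim_dist_triangle) (auto simp: ulim_seqs_def pointed_def)
  also have "\<dots> < \<infinity>"
    using assms by (auto simp: ulim_seqs_def ulim_dist_commute[of y])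
  finally show ?thesis .
qed

lemma equiv_ulim_rel: "equiv (ulim_seqs \<mu> P) (ulim_rel \<mu> P)"
proof (rule equivI)
  show "refl_on (ulim_seqs \<mu> P) (ulim_rel \<mu> P)"
    by (auto simp: refl_on_def ulim_rel_def ulim_seqs_def intro!: ulim_dist_refl)
  show "sym (ulim_rel \<mu> P)"
    by (auto simp: sym_def ulim_rel_def ulim_dist_commute)
  show "trans (ulim_rel \<mu> P)"
  proof (rule transI)
    fix x y z assume *: "(x, y) \<in> ulim_rel \<mu> P" "(y, z) \<in> ulim_rel \<mu> P"
    then have "ulim_dist \<mu> P x z \<le> ulim_dist \<mu> P x y + ulim_dist \<mu> P y z"
      by (intro ulim_dist_triangle) (auto simp: ulim_rel_def ulim_seqs_def)
    with * show "(x, z) \<in> ulim_rel \<mu> P" by (auto simp: ulim_rel_def)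
  qed
qed (auto simp: ulim_rel_def)

lemma ulim_dist_cong:
  assumes "(y, y') \<in> ulim_rel \<mu> P" "(z, z') \<in> ulim_rel \<mu> P"
  shows "ulim_dist \<mu> P y z = ulim_dist \<mu> P y' z'"
proof -
  have le: "ulim_dist \<mu> P u v \<le> ulim_dist \<mu> P u' v'"
    if "(u, u') \<in> ulim_rel \<mu> P" "(v, v') \<in> ulim_rel \<mu> P" for u v u' v'
  proof -
    have "ulim_dist \<mu> P u v \<le> ulim_dist \<mu> P u u' + ulim_dist \<mu> P u' v"
      using that by (intro ulim_dist_triangle) (auto simp: ulim_rel_def ulim_seqs_def)
    also have "ulim_dist \<mu> P u' v \<le> ulim_dist \<mu> P u' v' + ulim_dist \<mu> P v' v"
      using that by (intro ulim_dist_triangle) (auto simp: ulim_rel_def ulim_seqs_def)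
    finally show ?thesis
      using that by (simp add: ulim_rel_def ulim_dist_commute[of v'] add_left_mono)
  qed
  have "(y', y) \<in> ulim_rel \<mu> P" "(z', z) \<in> ulim_rel \<mu> P"
    using assms equiv_ulim_rel by (auto dest: equivE symD)
  then show ?thesis using le assms by (meson antisym)
qed

lemma ulim_class_rep:
  assumes "C \<in> ulim_seqs \<mu> P // ulim_rel \<mu> P" "y \<in> C"
  shows "(SOME y. y \<in> C) \<in> C" "(SOME y. y \<in> C) \<in> ulim_seqs \<mu> P"
    "((SOME y. y \<in> C), y) \<in> ulim_rel \<mu> P"
proof -
  show 1: "(SOME y. y \<in> C) \<in> C" using someI[of "\<lambda>y. y \<in> C", OF assms(2)] .
  show "((SOME y. y \<in> C), y) \<in> ulim_rel \<mu> P"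
    using quotient_eq_iff[OF equiv_ulim_rel assms(1) assms(1) 1 assms(2)] by simp
  then show "(SOME y. y \<in> C) \<in> ulim_seqs \<mu> P" by (simp add: ulim_rel_def)
qed

lemma Metric_space_ultralimit:
  "Metric_space (ulim_seqs \<mu> P // ulim_rel \<mu> P)
     (\<lambda>C D. enn2real (ulim_dist \<mu> P (SOME y. y \<in> C) (SOME z. z \<in> D)))"
proof
  have ne: "\<exists>y. y \<in> C" if "C \<in> ulim_seqs \<mu> P // ulim_rel \<mu> P" for C
    using in_quotient_imp_non_empty[OF equiv_ulim_rel that] by blast
  note rep = ulim_class_rep(1,2)[OF _ someI_ex[OF ne]]
  fix C D E
  show "0 \<le> enn2real (ulim_dist \<mu> P (SOME y. y \<in> C) (SOME z. z \<in> D))" by simp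
  show "enn2real (ulim_dist \<mu> P (SOME y. y \<in> C) (SOME z. z \<in> D))
      = enn2real (ulim_dist \<mu> P (SOME y. y \<in> D) (SOME z. z \<in> C))"
    by (simp add: ulim_dist_commute)
  assume C: "C \<in> ulim_seqs \<mu> P // ulim_rel \<mu> P" and D: "D \<in> ulim_seqs \<mu> P // ulim_rel \<mu> P"
  note rC = rep[OF C C] and rD = rep[OF D D]
  have "C = D \<longleftrightarrow> ((SOME y. y \<in> C), (SOME z. z \<in> D)) \<in> ulim_rel \<mu> P"
    using quotient_eq_iff[OF equiv_ulim_rel C D rC(1) rD(1)] by simp
  then show "enn2real (ulim_dist \<mu> P (SOME y. y \<in> C) (SOME z. z \<in> D)) = 0 \<longleftrightarrow> C = D"
    using rC(2) rD(2) ulim_dist_finite[OF rC(2) rD(2)] by (auto simp: ulim_rel_def enn2real_eq_0_iff)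
  assume E: "E \<in> ulim_seqs \<mu> P // ulim_rel \<mu> P"
  note rE = rep[OF E E]
  have "ulim_dist \<mu> P (SOME y. y \<in> C) (SOME z. z \<in> E)
      \<le> ulim_dist \<mu> P (SOME y. y \<in> C) (SOME z. z \<in> D) + ulim_dist \<mu> P (SOME y. y \<in> D) (SOME z. z \<in> E)"
    using rC(2) rD(2) rE(2) by (intro ulim_dist_triangle) (auto simp: ulim_seqs_def)
  then show "enn2real (ulim_dist \<mu> P (SOME y. y \<in> C) (SOME z. z \<in> E))
      \<le> enn2real (ulim_dist \<mu> P (SOME y. y \<in> C) (SOME z. z \<in> D))
        + enn2real (ulim_dist \<mu> P (SOME y. y \<in> D) (SOME z. z \<in> E))"
    using ulim_dist_finite[OF rC(2) rD(2)] ulim_dist_finite[OF rD(2) rE(2)]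
    by (simp add: enn2real_mono flip: enn2real_plus)
qed

lemma mspace_ultralimit: "mspace (pspace (ultralimit \<mu> P)) = ulim_seqs \<mu> P // ulim_rel \<mu> P"
  by (simp add: ultralimit_def Metric_space.mspace_metric[OF Metric_space_ultralimit])

lemma mdist_ultralimit:
  assumes "C \<in> ulim_seqs \<mu> P // ulim_rel \<mu> P" "D \<in> ulim_seqs \<mu> P // ulim_rel \<mu> P" "y \<in> C" "z \<in> D"
  shows "ennreal (mdist (pspace (ultralimit \<mu> P)) C D) = ulim_dist \<mu> P y z"
proof -
  have "ulim_dist \<mu> P (SOME y. y \<in> C) (SOME z. z \<in> D) = ulim_dist \<mu> P y z"
    by (intro ulim_dist_cong ulim_class_rep(3)[OF assms(1,3)] ulim_class_rep(3)[OF assms(2,4)])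
  moreover have "ulim_dist \<mu> P y z < \<infinity>"
    using assms equiv_ulim_rel by (intro ulim_dist_finite) (meson in_quotient_imp_subset subsetD)+
  ultimately show ?thesis
    by (simp add: ultralimit_def Metric_space.mdist_metric[OF Metric_space_ultralimit])
qed

lemma pointed_ultralimit: "pointed (ultralimit \<mu> P)"
proof -
  have "(\<lambda>n. basept (P n)) \<in> ulim_seqs \<mu> P"
    using P by (simp add: ulim_seqs_def pointed_def ulim_dist_refl)
  then show ?thesis
    by (simp add: pointed_def mspace_ultralimit) (simp add: ultralimit_def quotientI)
qed

end

lemma pointed_asymp_cone:
  assumes "ultrafilter \<mu>" "scaling_factor \<alpha>" "pointed P"
  shows "pointed (asymp_cone \<mu> \<alpha> P)"
  using assms unfolding asymp_cone_def
  by (intro pointed_ultralimit) (auto simp: pointed_def scaling_factor_def)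

lemma inj_on_encode_class_ultralimit:
  assumes "ultrafilter \<mu>" "\<And>n. pointed (P n)"
  shows "inj_on encode_class (mspace (pspace (ultralimit \<mu> P)))"
proof (rule inj_onI)
  note eq = equiv_ulim_rel[of \<mu> P, OF assms]
  fix C D assume CD: "C \<in> mspace (pspace (ultralimit \<mu> P))" "D \<in> mspace (pspace (ultralimit \<mu> P))"
    and e: "encode_class C = encode_class D"
  then have q: "C \<in> ulim_seqs \<mu> P // ulim_rel \<mu> P" "D \<in> ulim_seqs \<mu> P // ulim_rel \<mu> P"
    by (simp_all add: mspace_ultralimit[of \<mu> P, OF assms])
  have "(SOME y. y \<in> C) \<in> C" "(SOME y. y \<in> D) \<in> D"
    using q in_quotient_imp_non_empty[OF eq] by (simp_all add: some_in_eq)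
  with e have "C \<inter> D \<noteq> {}" by (auto simp: encode_class_def)
  then show "C = D" using quotient_disj[OF eq q] by blast
qed

lemma inj_on_encode_class_asymp_cone:
  assumes "ultrafilter \<mu>" "scaling_factor \<alpha>" "pointed P"
  shows "inj_on encode_class (mspace (pspace (asymp_cone \<mu> \<alpha> P)))"
  using assms unfolding asymp_cone_def
  by (intro inj_on_encode_class_ultralimit) (auto simp: pointed_def scaling_factor_def)

lemma pointed_transport:
  "inj_on f (mspace (pspace P)) \<Longrightarrow> pointed P \<Longrightarrow> pointed (transport f P)"
  by (simp add: pointed_def transport_simps)

lemma pointed_iter_cone:
  assumes "ultrafilter \<mu>" "scaling_factor \<alpha>" "pointed P"
  shows "pointed (iter_cone \<mu> \<alpha> P k n)"
  using assms
proof (induction \<mu> \<alpha> P k n rule: iter_cone.induct)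
  case (1 \<mu> \<alpha> P)
  then show ?case by (auto intro!: pointed_transport simp: inj_on_def)
next
  case (2 \<mu> \<alpha> P k n)
  then show ?case
    by (auto intro!: pointed_transport inj_on_encode_class_asymp_cone pointed_asymp_cone)
next
  case (3 \<mu> \<alpha> P k)
  then show ?case
    by (auto intro!: pointed_transport inj_on_encode_class_ultralimit pointed_ultralimit)
qed

end

theory Submission
  imports Defs
begin

text \<open>The space is a basepoint together with clusters, each a star with finitely many legs placed at
  distance \<open>2 ^ z\<close> from the basepoint; distinct clusters are so far apart that the connected
  components are exactly the clusters and the basepoint, and for \<open>t \<ge> 3\<close> a star with \<open>t\<close> legs is
  recognised topologically as a component with exactly \<open>t\<close> non-cut points. With scaling factors
  \<open>2 ^ 3 ^ n\<close>, a cone again consists of such clusters, and it has a \<open>t\<close>-legged star at level \<open>z\<close> iff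
  \<open>\<mu>\<close>-almost all \<open>n\<close> have one at level \<open>z + 3 ^ n\<close> in the space before. Passing to iterated cones thus
  becomes an iterated derivative of sets of integers. Each ordinal \<open>l\<close> gets its own number of
  legs, and its stars are placed at the levels \<open>3 ^ m\<^sub>1 + \<dots> + 3 ^ m\<^sub>j\<close>, \<open>m\<^sub>1 < \<dots> < m\<^sub>j\<close>, along which
  \<open>l\<close> can be counted down: reading \<open>m\<close> takes \<open>\<rho> + 1\<close> to \<open>\<rho>\<close> and \<open>\<omega> \<cdot> (a + 1)\<close> to \<open>\<omega> \<cdot> a + m\<close>.
  The \<open>\<xi>\<close>-th derivative of this set of levels is nonempty iff \<open>\<xi> \<le> l\<close>, so the stars of \<open>l\<close> occur
  exactly in the cones with index at most \<open>l\<close>.\<close>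

section \<open>Ultrafilters and ultralimits\<close>

lemma ultrafilter_not_iff:
  "ultrafilter \<mu> \<Longrightarrow> eventually (\<lambda>n. \<not> P n) \<mu> \<longleftrightarrow> \<not> eventually P \<mu>"
  unfolding ultrafilter_def using eventually_conj[of P \<mu> "\<lambda>n. \<not> P n"] by auto

text \<open>Pigeonhole principle for ultrafilters: if each of the finitely many alternatives failed
  to be large, all their negations would hold together on a large set.\<close>

lemma ultrafilter_bex_finite:
  assumes "ultrafilter \<mu>" "finite S" "\<forall>\<^sub>F n in \<mu>. \<exists>s\<in>S. Q s n"
  shows "\<exists>s\<in>S. \<forall>\<^sub>F n in \<mu>. Q s n"
proof (rule ccontr)
  assume "\<not> ?thesis"
  then have "\<forall>s\<in>S. \<forall>\<^sub>F n in \<mu>. \<not> Q s n"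
    using ultrafilter_not_iff[OF assms(1)] by blast
  then have "\<forall>\<^sub>F n in \<mu>. \<forall>s\<in>S. \<not> Q s n"
    using assms(2) by (simp add: eventually_ball_finite)
  then have "\<forall>\<^sub>F n in \<mu>. \<not> (\<exists>s\<in>S. Q s n)" by simp
  then show False using assms(1,3) ultrafilter_not_iff by blast
qed

text \<open>A bounded set of indices is a finite union of points, none of which is large. Hence
  whatever holds for all sufficiently large \<open>n\<close> holds \<mu>-almost everywhere.\<close>

lemma nonprincipal_le_sequentially:
  assumes "ultrafilter \<mu>" "nonprincipal \<mu>"
  shows "\<mu> \<le> sequentially"
proof -
  have "\<forall>\<^sub>F n in \<mu>. n \<in> {N..}" for N
  proof (rule ccontr)
    assume "\<not> eventually (\<lambda>n. n \<in> {N..}) \<mu>"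
    then have "\<forall>\<^sub>F n in \<mu>. n \<notin> {N..}"
      using ultrafilter_not_iff[OF assms(1)] by blast
    then have "\<forall>\<^sub>F n in \<mu>. \<exists>m\<in>{..<N}. n = m"
      by (rule eventually_mono) auto
    then have "\<exists>m\<in>{..<N}. \<forall>\<^sub>F n in \<mu>. n = m"
      using assms(1) by (intro ultrafilter_bex_finite) auto
    with assms(2) show False by (auto simp: nonprincipal_def)
  qed
  then show ?thesis by (simp add: le_INF_iff le_principal at_top_def)
qed

text \<open>The image filter has a cluster point in the compact set, and for an ultrafilter a
  cluster point is a limit. This makes the parameters of points on legs converge.\<close>

lemma ultrafilter_tendsto_compact:
  fixes x :: "'i \<Rightarrow> 'b::topological_space"
  assumes "ultrafilter \<mu>" "compact K" "\<forall>\<^sub>F n in \<mu>. x n \<in> K"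
  shows "\<exists>l\<in>K. (x \<longlongrightarrow> l) \<mu>"
proof -
  have "filtermap x \<mu> \<noteq> bot" "eventually (\<lambda>y. y \<in> K) (filtermap x \<mu>)"
    using assms by (simp_all add: ultrafilter_def filtermap_bot_iff eventually_filtermap)
  then obtain l where "l \<in> K" and l: "inf (nhds l) (filtermap x \<mu>) \<noteq> bot"
    using assms(2) unfolding compact_filter by blast
  have "(x \<longlongrightarrow> l) \<mu>"
  proof (rule topological_tendstoI, rule ccontr)
    fix U assume U: "open U" "l \<in> U" and "\<not> eventually (\<lambda>n. x n \<in> U) \<mu>"
    then have "eventually (\<lambda>y. y \<notin> U) (filtermap x \<mu>)"
      using ultrafilter_not_iff[OF assms(1)] by (simp add: eventually_filtermap)
    moreover have "eventually (\<lambda>y. y \<in> U) (nhds l)" using U by (rule eventually_nhds_in_open)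
    ultimately have "eventually (\<lambda>_. False) (inf (nhds l) (filtermap x \<mu>))"
      unfolding eventually_inf by blast
    then show False using l by (simp add: trivial_limit_def)
  qed
  with \<open>l \<in> K\<close> show ?thesis by blast
qed

section \<open>Points and distances of an ultralimit through representatives\<close>

abbreviation ulim_class :: "nat filter \<Rightarrow> (nat \<Rightarrow> 'a pointed_metric) \<Rightarrow> (nat \<Rightarrow> 'a) \<Rightarrow> (nat \<Rightarrow> 'a) set"
  where "ulim_class \<mu> P y \<equiv> ulim_rel \<mu> P `` {y}"

context
  fixes \<mu> :: "nat filter" and P :: "nat \<Rightarrow> 'a pointed_metric"
  assumes \<mu>: "ultrafilter \<mu>" and P: "\<And>n. pointed (P n)"
begin

lemma ulim_dist_eqI:
  "((\<lambda>n. mdist (pspace (P n)) (y n) (z n)) \<longlongrightarrow> l) \<mu> \<Longrightarrow> ulim_dist \<mu> P y z = ennreal l"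
  unfolding ulim_dist_def using \<mu>
  by (intro tendsto_Lim tendsto_ennrealI) (auto simp: ultrafilter_def)

lemma ulim_seqsI:
  assumes "\<And>n. y n \<in> mspace (pspace (P n))"
    and "((\<lambda>n. mdist (pspace (P n)) (basept (P n)) (y n)) \<longlongrightarrow> l) \<mu>"
  shows "y \<in> ulim_seqs \<mu> P"
  using assms ulim_dist_eqI[OF assms(2)] by (simp add: ulim_seqs_def)

lemma ulim_seqsD:
  assumes "y \<in> ulim_seqs \<mu> P"
  shows "\<exists>l. ((\<lambda>n. mdist (pspace (P n)) (basept (P n)) (y n)) \<longlongrightarrow> l) \<mu>"
proof -
  let ?l = "ulim_dist \<mu> P (\<lambda>n. basept (P n)) y"
  have "?l < \<infinity>" using assms by (simp add: ulim_seqs_def)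
  then have "((\<lambda>n. enn2real (ennreal (mdist (pspace (P n)) (basept (P n)) (y n)))) \<longlongrightarrow> enn2real ?l) \<mu>"
    using ulim_dist_tendsto[of \<mu> P, OF \<mu> P] by (intro tendsto_enn2real) auto
  then show ?thesis by auto
qed

lemma ulim_class_in_mspace:
  "y \<in> ulim_seqs \<mu> P \<Longrightarrow> ulim_class \<mu> P y \<in> mspace (pspace (ultralimit \<mu> P))"
  by (simp add: mspace_ultralimit[of \<mu> P, OF \<mu> P] quotientI)

lemma mspace_ultralimit_image:
  "mspace (pspace (ultralimit \<mu> P)) = ulim_class \<mu> P ` ulim_seqs \<mu> P"
  unfolding mspace_ultralimit[of \<mu> P, OF \<mu> P] quotient_def by blast

lemma mdist_ulim_class:
  assumes "y \<in> ulim_seqs \<mu> P" "z \<in> ulim_seqs \<mu> P"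
    and lim: "((\<lambda>n. mdist (pspace (P n)) (y n) (z n)) \<longlongrightarrow> l) \<mu>"
  shows "mdist (pspace (ultralimit \<mu> P)) (ulim_class \<mu> P y) (ulim_class \<mu> P z) = l"
proof -
  have "l \<ge> 0"
    using lim by (rule tendsto_lowerbound) (use \<mu> in \<open>auto simp: ultrafilter_def\<close>)
  moreover have "ennreal (mdist (pspace (ultralimit \<mu> P)) (ulim_class \<mu> P y) (ulim_class \<mu> P z))
      = ulim_dist \<mu> P y z"
    using assms(1,2) equiv_ulim_rel[of \<mu> P, OF \<mu> P]
    by (intro mdist_ultralimit[of \<mu> P, OF \<mu> P]) (auto simp: quotientI dest: equiv_class_self)
  ultimately show ?thesis
    using ulim_dist_eqI[OF lim] by (simp add: ennreal_inj)
qed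

lemma ulim_class_eqI:
  assumes "y \<in> ulim_seqs \<mu> P" "z \<in> ulim_seqs \<mu> P"
    and "((\<lambda>n. mdist (pspace (P n)) (y n) (z n)) \<longlongrightarrow> 0) \<mu>"
  shows "ulim_class \<mu> P y = ulim_class \<mu> P z"
  using mdist_ulim_class[OF assms] assms(1,2) by (simp add: ulim_class_in_mspace)

lemma basept_ultralimit: "basept (ultralimit \<mu> P) = ulim_class \<mu> P (\<lambda>n. basept (P n))"
  by (simp add: ultralimit_def)

lemma basept_in_ulim_seqs: "(\<lambda>n. basept (P n)) \<in> ulim_seqs \<mu> P"
proof (rule ulim_seqsI)
  show in_M: "basept (P n) \<in> mspace (pspace (P n))" for n
    using P[of n] by (simp add: pointed_def)
  have "mdist (pspace (P n)) (basept (P n)) (basept (P n)) = 0" for n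
    using in_M[of n] by simp
  then show "((\<lambda>n. mdist (pspace (P n)) (basept (P n)) (basept (P n))) \<longlongrightarrow> 0) \<mu>"
    by simp
qed

end

section \<open>Spaces of hedgehogs\<close>

definition height :: "'a pointed_metric \<Rightarrow> (real \<Rightarrow> 'a) \<Rightarrow> real" where
  "height P g = mdist (pspace P) (basept P) (g 0)"

text \<open>A leg is a curve \<open>g\<close> on \<open>[0, 1]\<close> from the centre \<open>g 0\<close> of its star to its tip \<open>g 1\<close>. Legs are
  compared through their tips and centres only, as the values outside \<open>[0, 1]\<close> are arbitrary.\<close>

definition hedgehogs :: "'a pointed_metric \<Rightarrow> (real \<Rightarrow> 'a) set \<Rightarrow> bool" where
  "hedgehogs P G \<longleftrightarrow>
     mspace (pspace P) = insert (basept P) (\<Union>g\<in>G. g ` {0..1}) \<and>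
     (\<forall>g\<in>G. \<exists>z::int. \<forall>r\<in>{0..1}. mdist (pspace P) (basept P) (g r) = 2 powi z) \<and>
     (\<forall>g\<in>G. \<forall>g'\<in>G. \<forall>r\<in>{0..1}. \<forall>s\<in>{0..1}. mdist (pspace P) (g r) (g' s) =
        (if g 1 = g' 1 then height P g * \<bar>r - s\<bar> / 4
         else if g 0 = g' 0 then height P g * (r + s) / 4
         else max (height P g) (height P g')))"

definition tips :: "(real \<Rightarrow> 'a) set \<Rightarrow> (real \<Rightarrow> 'a) \<Rightarrow> 'a set" where
  "tips G g = {g' 1 |g'. g' \<in> G \<and> g' 0 = g 0}"

text \<open>As \<open>card\<close> is 0 on infinite sets, t = 0 would collect the stars with
  infinitely many legs, which ultralimits may create. Positive t stand for stars with exactly t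
  legs.\<close>

definition levels :: "'a pointed_metric \<Rightarrow> (real \<Rightarrow> 'a) set \<Rightarrow> nat \<Rightarrow> int set" where
  "levels P G t = {z. \<exists>g\<in>G. height P g = 2 powi z \<and> card (tips G g) = t}"

lemma hedgehogs_pointed: "hedgehogs P G \<Longrightarrow> pointed P"
  by (simp add: hedgehogs_def pointed_def)

lemma hedgehogs_mspace:
  "hedgehogs P G \<Longrightarrow> mspace (pspace P) = insert (basept P) (\<Union>g\<in>G. g ` {0..1})"
  by (simp add: hedgehogs_def)

lemma hedgehogs_in_mspace:
  "hedgehogs P G \<Longrightarrow> g \<in> G \<Longrightarrow> r \<in> {0..1} \<Longrightarrow> g r \<in> mspace (pspace P)"
  unfolding hedgehogs_mspace by blast

lemma hedgehogs_height_powi: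
  assumes "hedgehogs P G" "g \<in> G"
  shows "\<exists>z::int. height P g = 2 powi z"
  using assms unfolding hedgehogs_def height_def by fastforce

lemma hedgehogs_height_pos: "hedgehogs P G \<Longrightarrow> g \<in> G \<Longrightarrow> 0 < height P g"
  using hedgehogs_height_powi[of P G g] by (auto simp: zero_less_power_int)

lemma hedgehogs_mdist_basept:
  assumes "hedgehogs P G" "g \<in> G" "r \<in> {0..1}"
  shows "mdist (pspace P) (basept P) (g r) = height P g"
proof -
  obtain z :: int where "\<forall>r\<in>{0..1}. mdist (pspace P) (basept P) (g r) = 2 powi z"
    using assms(1,2) unfolding hedgehogs_def by blast
  then show ?thesis using assms(3) by (simp add: height_def)
qed

lemma hedgehogs_mdist:
  assumes "hedgehogs P G" "g \<in> G" "g' \<in> G" "r \<in> {0..1}" "s \<in> {0..1}"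
  shows "mdist (pspace P) (g r) (g' s) =
        (if g 1 = g' 1 then height P g * \<bar>r - s\<bar> / 4
         else if g 0 = g' 0 then height P g * (r + s) / 4
         else max (height P g) (height P g'))"
  using assms unfolding hedgehogs_def by blast

text \<open>With equal tips the distance at equal parameters is 0, so a tip determines its leg on
  [0, 1], the centre included.\<close>

lemma hedgehogs_same_tip:
  assumes "hedgehogs P G" "g \<in> G" "g' \<in> G" "g 1 = g' 1" "r \<in> {0..1}"
  shows "g r = g' r"
proof -
  have "mdist (pspace P) (g r) (g' r) = 0"
    using hedgehogs_mdist[OF assms(1-3,5,5)] assms(4) by simp
  then show ?thesis
    using hedgehogs_in_mspace[OF assms(1)] assms by simp
qed

text \<open>\<open>{..m}\<close> has m + 1 elements, so the left side speaks of m + 1 distinct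
  points. In this form bounds on cardinalities can be passed through an ultralimit.\<close>

lemma ex_inj_on_atMost_iff:
  "(\<exists>f. inj_on f {..m::nat} \<and> f ` {..m} \<subseteq> S) \<longleftrightarrow> \<not> (finite S \<and> card S \<le> m)"
proof
  assume "\<exists>f. inj_on f {..m} \<and> f ` {..m} \<subseteq> S"
  then obtain f where "inj_on f {..m}" "f ` {..m} \<subseteq> S" by blast
  then show "\<not> (finite S \<and> card S \<le> m)"
    using card_inj_on_le[of f "{..m}" S] by auto
next
  assume *: "\<not> (finite S \<and> card S \<le> m)"
  have "\<exists>T\<subseteq>S. finite T \<and> card T = Suc m"
  proof (cases "finite S")
    case True
    then show ?thesis using * obtain_subset_with_card_n[of "Suc m" S] by (metis finite_subset not_less_eq_eq)
  next
    case False
    then show ?thesis using infinite_arbitrarily_large by blast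
  qed
  then obtain T where T: "T \<subseteq> S" "finite T" "card T = card {..m}" by auto
  then obtain f where "bij_betw f {..m} T"
    using finite_same_card_bij[of "{..m}" T] by auto
  then show "\<exists>f. inj_on f {..m} \<and> f ` {..m} \<subseteq> S"
    using T(1) by (auto simp: bij_betw_def)
qed

lemma two_powi_less_iff: "(2::real) powi a < 2 powi b \<longleftrightarrow> a < b"
  using power_int_strict_increasing[of a b "2::real"] power_int_strict_increasing[of b a "2::real"]
  by (cases a b rule: linorder_cases) auto

lemma two_powi_eq_iff: "(2::real) powi a = 2 powi b \<longleftrightarrow> a = b"
  using two_powi_less_iff[of a b] two_powi_less_iff[of b a]
  by (cases a b rule: linorder_cases) auto

text \<open>Powers of two accumulate only at 0. Heights near a positive limit therefore take
  finitely many values, and the pigeonhole principle makes the level constant almost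
  everywhere.\<close>

lemma finite_powi_interval:
  fixes a b :: real
  assumes "0 < a"
  shows "finite {z::int. 2 powi z \<in> {a<..<b}}"
proof -
  obtain n where n: "1 / a < 2 ^ n" using real_arch_pow[of 2 "1/a"] by auto
  obtain m where m: "b < 2 ^ m" using real_arch_pow[of 2 b] by auto
  have "{z::int. 2 powi z \<in> {a<..<b}} \<subseteq> {- int n .. int m}"
  proof
    fix z :: int assume "z \<in> {z. 2 powi z \<in> {a<..<b}}"
    then have z: "a < 2 powi z" "(2::real) powi z < b" by auto
    have "(2::real) powi z < 2 powi int m" using z m by simp
    then have "z < int m" by (simp only: two_powi_less_iff)
    have "(2::real) powi (- int n) < a"
      using n assms by (simp add: power_int_minus field_simps)
    then have "(2::real) powi (- int n) < 2 powi z" using z by simp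
    then have "- int n < z" by (simp only: two_powi_less_iff)
    with \<open>z < int m\<close> show "z \<in> {- int n .. int m}" by simp
  qed
  then show ?thesis by (rule finite_subset) simp
qed

section \<open>Ultralimits of hedgehogs\<close>

text \<open>The constant curve at the basepoint is a filler, since \<open>G n\<close> may be empty for some \<open>n\<close>.\<close>

definition curve_seqs ::
  "nat filter \<Rightarrow> (nat \<Rightarrow> 'a pointed_metric) \<Rightarrow> (nat \<Rightarrow> (real \<Rightarrow> 'a) set) \<Rightarrow> int \<Rightarrow> (nat \<Rightarrow> real \<Rightarrow> 'a) set"
  where "curve_seqs \<mu> P G z = {g. (\<forall>n. g n \<in> insert (\<lambda>_. basept (P n)) (G n)) \<and>
    (\<forall>\<^sub>F n in \<mu>. g n \<in> G n \<and> height (P n) (g n) = 2 powi z)}"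

definition lim_curve :: "nat filter \<Rightarrow> (nat \<Rightarrow> 'a pointed_metric) \<Rightarrow> (nat \<Rightarrow> real \<Rightarrow> 'a) \<Rightarrow> real \<Rightarrow> (nat \<Rightarrow> 'a) set"
  where "lim_curve \<mu> P g r = ulim_class \<mu> P (\<lambda>n. g n r)"

context
  fixes \<mu> :: "nat filter" and P :: "nat \<Rightarrow> 'a pointed_metric" and G :: "nat \<Rightarrow> (real \<Rightarrow> 'a) set"
  assumes \<mu>: "ultrafilter \<mu>" and PG: "\<And>n. hedgehogs (P n) (G n)"
begin

private lemma P: "pointed (P n)" for n
  using PG hedgehogs_pointed by blast

lemma curve_seq_value_in_mspace:
  assumes "g \<in> curve_seqs \<mu> P G z" "r \<in> {0..1}"
  shows "g n r \<in> mspace (pspace (P n))"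
proof -
  have "g n = (\<lambda>_. basept (P n)) \<or> g n \<in> G n"
    using assms(1) by (auto simp: curve_seqs_def)
  then show ?thesis
    using P[of n] hedgehogs_in_mspace[OF PG[of n] _ assms(2)] by (auto simp: pointed_def)
qed

lemma curve_seq_mdist_basept:
  assumes "g \<in> curve_seqs \<mu> P G z" "r \<in> {0..1}"
  shows "\<forall>\<^sub>F n in \<mu>. mdist (pspace (P n)) (basept (P n)) (g n r) = 2 powi z"
proof -
  have "\<forall>\<^sub>F n in \<mu>. g n \<in> G n \<and> height (P n) (g n) = 2 powi z"
    using assms(1) by (simp add: curve_seqs_def)
  then show ?thesis
    by eventually_elim (simp add: hedgehogs_mdist_basept[OF PG _ assms(2)])
qed

lemma curve_seq_in_ulim_seqs:
  assumes "g \<in> curve_seqs \<mu> P G z" "r \<in> {0..1}"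
  shows "(\<lambda>n. g n r) \<in> ulim_seqs \<mu> P"
  using curve_seq_mdist_basept[OF assms] curve_seq_value_in_mspace[OF assms]
  by (intro ulim_seqsI[OF \<mu> P]) (auto intro: tendsto_eventually)

section \<open>Limit curves and the distances between them\<close>

lemma lim_curve_in_mspace:
  assumes "g \<in> curve_seqs \<mu> P G z" "r \<in> {0..1}"
  shows "lim_curve \<mu> P g r \<in> mspace (pspace (ultralimit \<mu> P))"
  unfolding lim_curve_def
  by (rule ulim_class_in_mspace[OF \<mu> P]) (rule curve_seq_in_ulim_seqs[OF assms])

lemma mdist_basept_lim_curve:
  assumes "g \<in> curve_seqs \<mu> P G z" "r \<in> {0..1}"
  shows "mdist (pspace (ultralimit \<mu> P)) (basept (ultralimit \<mu> P)) (lim_curve \<mu> P g r) = 2 powi z"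
  unfolding lim_curve_def basept_ultralimit[OF \<mu> P]
  using curve_seq_mdist_basept[OF assms] curve_seq_in_ulim_seqs[OF assms]
  by (intro mdist_ulim_class[OF \<mu> P] basept_in_ulim_seqs[OF \<mu> P]) (auto intro: tendsto_eventually)

lemma height_lim_curve:
  "g \<in> curve_seqs \<mu> P G z \<Longrightarrow> height (ultralimit \<mu> P) (lim_curve \<mu> P g) = 2 powi z"
  unfolding height_def by (rule mdist_basept_lim_curve) auto

lemma mdist_lim_curve:
  assumes g: "g \<in> curve_seqs \<mu> P G z" and g': "g' \<in> curve_seqs \<mu> P G z'"
    and rs: "r \<in> {0..1}" "s \<in> {0..1}"
  shows "mdist (pspace (ultralimit \<mu> P)) (lim_curve \<mu> P g r) (lim_curve \<mu> P g' s) =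
     (if \<forall>\<^sub>F n in \<mu>. g n 1 = g' n 1 then 2 powi z * \<bar>r - s\<bar> / 4
      else if \<forall>\<^sub>F n in \<mu>. g n 0 = g' n 0 then 2 powi z * (r + s) / 4
      else max (2 powi z) (2 powi z'))" (is "_ = ?c")
proof -
  \<comment> \<open>The ultrafilter decides both case distinctions of the distance formula, so the
    distances are almost everywhere equal to one constant.\<close>
  have tip: "\<forall>\<^sub>F n in \<mu>. g n 1 = g' n 1 \<longleftrightarrow> (\<forall>\<^sub>F n in \<mu>. g n 1 = g' n 1)"
    by (cases "\<forall>\<^sub>F n in \<mu>. g n 1 = g' n 1")
      (use ultrafilter_not_iff[OF \<mu>, of "\<lambda>n. g n 1 = g' n 1"] in auto)
  have root: "\<forall>\<^sub>F n in \<mu>. g n 0 = g' n 0 \<longleftrightarrow> (\<forall>\<^sub>F n in \<mu>. g n 0 = g' n 0)"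
    by (cases "\<forall>\<^sub>F n in \<mu>. g n 0 = g' n 0")
      (use ultrafilter_not_iff[OF \<mu>, of "\<lambda>n. g n 0 = g' n 0"] in auto)
  have "\<forall>\<^sub>F n in \<mu>. g n \<in> G n \<and> height (P n) (g n) = 2 powi z"
    "\<forall>\<^sub>F n in \<mu>. g' n \<in> G n \<and> height (P n) (g' n) = 2 powi z'"
    using g g' by (simp_all add: curve_seqs_def)
  then have "\<forall>\<^sub>F n in \<mu>. mdist (pspace (P n)) (g n r) (g' n s) = ?c"
    using tip root by eventually_elim (simp add: hedgehogs_mdist[OF PG _ _ rs])
  then show ?thesis
    unfolding lim_curve_def
    using curve_seq_in_ulim_seqs[OF g rs(1)] curve_seq_in_ulim_seqs[OF g' rs(2)]
    by (intro mdist_ulim_class[OF \<mu> P]) (auto intro: tendsto_eventually)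
qed

lemma lim_curve_tip_eq_iff:
  assumes g: "g \<in> curve_seqs \<mu> P G z" and g': "g' \<in> curve_seqs \<mu> P G z'"
  shows "lim_curve \<mu> P g 1 = lim_curve \<mu> P g' 1 \<longleftrightarrow> (\<forall>\<^sub>F n in \<mu>. g n 1 = g' n 1)"
proof -
  have "lim_curve \<mu> P g 1 = lim_curve \<mu> P g' 1 \<longleftrightarrow>
      mdist (pspace (ultralimit \<mu> P)) (lim_curve \<mu> P g 1) (lim_curve \<mu> P g' 1) = 0"
    using lim_curve_in_mspace[OF g, of 1] lim_curve_in_mspace[OF g', of 1] by simp
  moreover have "max (2 powi z) (2 powi z') > (0::real)"
    by (simp add: zero_less_power_int less_max_iff_disj)
  ultimately show ?thesis
    using mdist_lim_curve[OF g g', of 1 1] by (auto simp: power_int_eq_0_iff)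
qed

lemma lim_curve_root_eq_iff:
  assumes g: "g \<in> curve_seqs \<mu> P G z" and g': "g' \<in> curve_seqs \<mu> P G z'"
  shows "lim_curve \<mu> P g 0 = lim_curve \<mu> P g' 0 \<longleftrightarrow> (\<forall>\<^sub>F n in \<mu>. g n 0 = g' n 0)"
proof -
  have "lim_curve \<mu> P g 0 = lim_curve \<mu> P g' 0 \<longleftrightarrow>
      mdist (pspace (ultralimit \<mu> P)) (lim_curve \<mu> P g 0) (lim_curve \<mu> P g' 0) = 0"
    using lim_curve_in_mspace[OF g, of 0] lim_curve_in_mspace[OF g', of 0] by simp
  moreover have "max (2 powi z) (2 powi z') > (0::real)"
    by (simp add: zero_less_power_int less_max_iff_disj)
  \<comment> \<open>At r = s = 0 the distance also vanishes in the case of equal tips, where the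
    centres have to be shown equal as well.\<close>
  moreover have "\<forall>\<^sub>F n in \<mu>. g n 0 = g' n 0" if "\<forall>\<^sub>F n in \<mu>. g n 1 = g' n 1"
  proof -
    have "\<forall>\<^sub>F n in \<mu>. g n \<in> G n" "\<forall>\<^sub>F n in \<mu>. g' n \<in> G n"
      using g g' by (auto simp: curve_seqs_def elim: eventually_mono)
    then show ?thesis
      using that by eventually_elim (rule hedgehogs_same_tip[OF PG], auto)
  qed
  ultimately show ?thesis
    using mdist_lim_curve[OF g g', of 0 0] by (auto simp: power_int_eq_0_iff)
qed

definition lim_curves :: "(real \<Rightarrow> (nat \<Rightarrow> 'a) set) set" where
  "lim_curves = (\<Union>z. lim_curve \<mu> P ` curve_seqs \<mu> P G z)"

text \<open>A point other than the basepoint has a positive finite distance L from it. Only finitely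
  many levels are near L, so almost all terms of a representative lie on legs of one level.
  Compactness of [0, 1] makes their parameters converge, and the limit curve passes through the
  point at the limiting parameter.\<close>

lemma mspace_ultralimit_hedgehogs:
  "mspace (pspace (ultralimit \<mu> P)) = insert (basept (ultralimit \<mu> P)) (\<Union>g\<in>lim_curves. g ` {0..1})"
proof (intro equalityI subsetI)
  fix C assume "C \<in> mspace (pspace (ultralimit \<mu> P))"
  then obtain y where y: "y \<in> ulim_seqs \<mu> P" and C: "C = ulim_class \<mu> P y"
    by (auto simp: mspace_ultralimit_image[OF \<mu> P])
  let ?d = "\<lambda>n. mdist (pspace (P n)) (basept (P n)) (y n)"
  have yM: "y n \<in> mspace (pspace (P n))" for n
    using y by (simp add: ulim_seqs_def)
  obtain L where L: "(?d \<longlongrightarrow> L) \<mu>" using ulim_seqsD[OF \<mu> P y] by blast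
  have "L \<ge> 0"
    using L by (rule tendsto_lowerbound) (use \<mu> in \<open>auto simp: ultrafilter_def\<close>)
  show "C \<in> insert (basept (ultralimit \<mu> P)) (\<Union>g\<in>lim_curves. g ` {0..1})"
  proof (cases "L = 0")
    case True
    then have "basept (ultralimit \<mu> P) = C"
      unfolding C basept_ultralimit[OF \<mu> P] using L y
      by (intro ulim_class_eqI[OF \<mu> P] basept_in_ulim_seqs[OF \<mu> P]) auto
    then show ?thesis by simp
  next
    case False
    with \<open>L \<ge> 0\<close> have "0 < L" by simp
    \<comment> \<open>The bounds only have to enclose L and to stay away from 0.\<close>
    let ?S = "{z::int. 2 powi z \<in> {L/2<..<2*L}}"
    have "\<forall>\<^sub>F n in \<mu>. L/2 < ?d n" "\<forall>\<^sub>F n in \<mu>. ?d n < 2*L"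
      by (rule order_tendstoD[OF L]; use \<open>0 < L\<close> in simp)+
    then have "\<forall>\<^sub>F n in \<mu>. \<exists>z\<in>?S. \<exists>g\<in>G n. height (P n) g = 2 powi z \<and> y n \<in> g ` {0..1}"
    proof eventually_elim
      case (elim n)
      then have "?d n \<noteq> 0" using \<open>0 < L\<close> by auto
      then have "y n \<noteq> basept (P n)" using yM[of n] by auto
      then obtain g r where g: "g \<in> G n" "r \<in> {0..1}" "y n = g r"
        using yM[of n] hedgehogs_mspace[OF PG, of n] by auto
      obtain z :: int where z: "height (P n) g = 2 powi z"
        using hedgehogs_height_powi[OF PG g(1)] by blast
      then have "z \<in> ?S"
        using elim hedgehogs_mdist_basept[OF PG g(1,2)] g(3) by simp
      with g z show ?case by blast
    qed
    then have "\<exists>z\<in>?S. \<forall>\<^sub>F n in \<mu>. \<exists>g\<in>G n. height (P n) g = 2 powi z \<and> y n \<in> g ` {0..1}"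
      using \<open>0 < L\<close> by (intro ultrafilter_bex_finite[OF \<mu>] finite_powi_interval) auto
    then obtain z where z: "\<forall>\<^sub>F n in \<mu>. \<exists>g\<in>G n. height (P n) g = 2 powi z \<and> y n \<in> g ` {0..1}"
      by blast
    \<comment> \<open>A curve and a parameter are chosen for every n; where no suitable leg exists,
      the curve is the constant filler.\<close>
    have "\<exists>g r. g \<in> insert (\<lambda>_. basept (P n)) (G n) \<and> r \<in> {0..1} \<and>
       ((\<exists>g\<in>G n. height (P n) g = 2 powi z \<and> y n \<in> g ` {0..1}) \<longrightarrow>
         g \<in> G n \<and> height (P n) g = 2 powi z \<and> y n = g r)" for n
    proof (cases "\<exists>g\<in>G n. height (P n) g = 2 powi z \<and> y n \<in> g ` {0..1}")
      case True
      then show ?thesis by blast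
    next
      case False
      then show ?thesis by (intro exI[of _ "\<lambda>_. basept (P n)"] exI[of _ 0]) auto
    qed
    then obtain g r where gr: "g n \<in> insert (\<lambda>_. basept (P n)) (G n)" "r n \<in> {0..1}"
       "(\<exists>g\<in>G n. height (P n) g = 2 powi z \<and> y n \<in> g ` {0..1}) \<longrightarrow>
         g n \<in> G n \<and> height (P n) (g n) = 2 powi z \<and> y n = g n (r n)" for n
      by metis
    from z have ev: "\<forall>\<^sub>F n in \<mu>. g n \<in> G n \<and> height (P n) (g n) = 2 powi z \<and> y n = g n (r n)"
      by eventually_elim (use gr(3) in blast)
    then have g: "g \<in> curve_seqs \<mu> P G z"
      using gr(1) unfolding curve_seqs_def by (auto elim: eventually_mono)
    obtain r' where r': "r' \<in> {0..1}" "(r \<longlongrightarrow> r') \<mu>"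
      using ultrafilter_tendsto_compact[OF \<mu> compact_Icc, of r 0 1] gr(2) by auto
    \<comment> \<open>Replacing the moving parameter by its limit displaces the point by a distance
      that tends to 0.\<close>
    have "((\<lambda>n. 2 powi z * \<bar>r n - r'\<bar> / 4) \<longlongrightarrow> 2 powi z * \<bar>r' - r'\<bar> / 4) \<mu>"
      by (intro tendsto_intros r') auto
    moreover from ev have "\<forall>\<^sub>F n in \<mu>. 2 powi z * \<bar>r n - r'\<bar> / 4 = mdist (pspace (P n)) (y n) (g n r')"
      by eventually_elim (simp add: hedgehogs_mdist[OF PG _ _ gr(2) r'(1)])
    ultimately have "((\<lambda>n. mdist (pspace (P n)) (y n) (g n r')) \<longlongrightarrow> 0) \<mu>"
      using tendsto_cong by fastforce
    then have "C = lim_curve \<mu> P g r'"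
      unfolding C lim_curve_def using y curve_seq_in_ulim_seqs[OF g r'(1)]
      by (intro ulim_class_eqI[OF \<mu> P])
    then show ?thesis using g r'(1) unfolding lim_curves_def by blast
  qed
next
  fix C assume "C \<in> insert (basept (ultralimit \<mu> P)) (\<Union>g\<in>lim_curves. g ` {0..1})"
  then show "C \<in> mspace (pspace (ultralimit \<mu> P))"
    using pointed_ultralimit[of \<mu> P, OF \<mu> P] lim_curve_in_mspace
    by (auto simp: pointed_def lim_curves_def)
qed

lemma hedgehogs_ultralimit: "hedgehogs (ultralimit \<mu> P) lim_curves"
proof -
  let ?U = "ultralimit \<mu> P"
  have height: "\<exists>z::int. \<forall>r\<in>{0..1}. mdist (pspace ?U) (basept ?U) (g r) = 2 powi z"
    if g: "g \<in> lim_curves" for g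
  proof -
    obtain z h where "h \<in> curve_seqs \<mu> P G z" "g = lim_curve \<mu> P h"
      using g unfolding lim_curves_def by blast
    then show ?thesis using mdist_basept_lim_curve by blast
  qed
  have dist: "mdist (pspace ?U) (g r) (g' s) =
        (if g 1 = g' 1 then height ?U g * \<bar>r - s\<bar> / 4
         else if g 0 = g' 0 then height ?U g * (r + s) / 4
         else max (height ?U g) (height ?U g'))"
    if g: "g \<in> lim_curves" and g': "g' \<in> lim_curves" and rs: "r \<in> {0..1}" "s \<in> {0..1}" for g g' r s
  proof -
    obtain z h where h: "h \<in> curve_seqs \<mu> P G z" "g = lim_curve \<mu> P h"
      using g unfolding lim_curves_def by blast
    obtain z' h' where h': "h' \<in> curve_seqs \<mu> P G z'" "g' = lim_curve \<mu> P h'"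
      using g' unfolding lim_curves_def by blast
    show ?thesis
      unfolding h(2) h'(2) mdist_lim_curve[OF h(1) h'(1) rs] height_lim_curve[OF h(1)]
        height_lim_curve[OF h'(1)] lim_curve_tip_eq_iff[OF h(1) h'(1)]
        lim_curve_root_eq_iff[OF h(1) h'(1)] by (rule refl)
  qed
  show ?thesis
    unfolding hedgehogs_def
    by (intro conjI ballI mspace_ultralimit_hedgehogs height dist)
qed

text \<open>Having more than m legs means having m + 1 distinct tips that share a centre. Finitely
  many equalities and inequalities between limit curves hold together at almost every index;
  conversely, m + 1 legs chosen at each index give m + 1 limit curves.\<close>

lemma tips_lim_curve:
  assumes g: "g \<in> curve_seqs \<mu> P G z"
  shows "finite (tips lim_curves (lim_curve \<mu> P g)) \<and> card (tips lim_curves (lim_curve \<mu> P g)) \<le> m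
    \<longleftrightarrow> (\<forall>\<^sub>F n in \<mu>. finite (tips (G n) (g n)) \<and> card (tips (G n) (g n)) \<le> m)"
proof -
  have gG: "\<forall>\<^sub>F n in \<mu>. g n \<in> G n \<and> height (P n) (g n) = 2 powi z"
    using g by (simp add: curve_seqs_def)
  have "(\<exists>f. inj_on f {..m} \<and> f ` {..m} \<subseteq> tips lim_curves (lim_curve \<mu> P g)) \<longleftrightarrow>
     (\<forall>\<^sub>F n in \<mu>. \<exists>f. inj_on f {..m} \<and> f ` {..m} \<subseteq> tips (G n) (g n))"
  proof
    assume "\<exists>f. inj_on f {..m} \<and> f ` {..m} \<subseteq> tips lim_curves (lim_curve \<mu> P g)"
    then obtain f where f: "inj_on f {..m}" "f ` {..m} \<subseteq> tips lim_curves (lim_curve \<mu> P g)" by blast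
    have "\<forall>i\<in>{..m}. \<exists>h. (\<exists>z. h \<in> curve_seqs \<mu> P G z) \<and> f i = lim_curve \<mu> P h 1 \<and>
       lim_curve \<mu> P h 0 = lim_curve \<mu> P g 0"
    proof
      fix i assume "i \<in> {..m}"
      then have "f i \<in> tips lim_curves (lim_curve \<mu> P g)" using f(2) by blast
      then show "\<exists>h. (\<exists>z. h \<in> curve_seqs \<mu> P G z) \<and> f i = lim_curve \<mu> P h 1 \<and>
       lim_curve \<mu> P h 0 = lim_curve \<mu> P g 0"
        unfolding tips_def lim_curves_def by blast
    qed
    then obtain h where h: "\<And>i. i \<in> {..m} \<Longrightarrow> \<exists>z. h i \<in> curve_seqs \<mu> P G z"
        "\<And>i. i \<in> {..m} \<Longrightarrow> f i = lim_curve \<mu> P (h i) 1"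
        "\<And>i. i \<in> {..m} \<Longrightarrow> lim_curve \<mu> P (h i) 0 = lim_curve \<mu> P g 0"
      by metis
    have "\<forall>\<^sub>F n in \<mu>. \<forall>i\<in>{..m}. h i n \<in> G n \<and> h i n 0 = g n 0"
    proof (rule eventually_ball_finite)
      show "\<forall>i\<in>{..m}. \<forall>\<^sub>F n in \<mu>. h i n \<in> G n \<and> h i n 0 = g n 0"
      proof
        fix i assume i: "i \<in> {..m}"
        then obtain z' where z': "h i \<in> curve_seqs \<mu> P G z'" using h(1) by blast
        have "\<forall>\<^sub>F n in \<mu>. h i n 0 = g n 0"
          using lim_curve_root_eq_iff[OF z' g] h(3)[OF i] by blast
        moreover have "\<forall>\<^sub>F n in \<mu>. h i n \<in> G n \<and> height (P n) (h i n) = 2 powi z'"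
          using z' by (simp add: curve_seqs_def)
        ultimately show "\<forall>\<^sub>F n in \<mu>. h i n \<in> G n \<and> h i n 0 = g n 0"
          by eventually_elim auto
      qed
    qed auto
    moreover have "\<forall>\<^sub>F n in \<mu>. \<forall>i\<in>{..m}. \<forall>j\<in>{..m}. i \<noteq> j \<longrightarrow> h i n 1 \<noteq> h j n 1"
    proof (intro eventually_ball_finite ballI)
      fix i j assume i: "i \<in> {..m}" and j: "j \<in> {..m}"
      show "\<forall>\<^sub>F n in \<mu>. i \<noteq> j \<longrightarrow> h i n 1 \<noteq> h j n 1"
      proof (cases "i = j")
        case False
        then have "f i \<noteq> f j" using f(1) i j by (auto dest: inj_onD)
        moreover obtain z1 z2 where "h i \<in> curve_seqs \<mu> P G z1" "h j \<in> curve_seqs \<mu> P G z2"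
          using h(1) i j by blast
        ultimately show ?thesis
          using lim_curve_tip_eq_iff h(2)[OF i] h(2)[OF j] False ultrafilter_not_iff[OF \<mu>] by simp
      qed simp
    qed auto
    ultimately show "\<forall>\<^sub>F n in \<mu>. \<exists>f. inj_on f {..m} \<and> f ` {..m} \<subseteq> tips (G n) (g n)"
    proof eventually_elim
      case (elim n)
      then have "inj_on (\<lambda>i. h i n 1) {..m}" by (meson inj_onI)
      moreover have "(\<lambda>i. h i n 1) ` {..m} \<subseteq> tips (G n) (g n)"
        using elim(1) unfolding tips_def by blast
      ultimately show ?case by (intro exI[of _ "\<lambda>i. h i n 1"]) simp
    qed
  next
    let ?Q = "\<lambda>n h. (\<forall>i\<in>{..m}. h i \<in> G n \<and> h i 0 = g n 0) \<and> inj_on (\<lambda>i. h i 1) {..m}"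
    assume "\<forall>\<^sub>F n in \<mu>. \<exists>f. inj_on f {..m} \<and> f ` {..m} \<subseteq> tips (G n) (g n)"
    then have ev: "\<forall>\<^sub>F n in \<mu>. \<exists>h. ?Q n h"
    proof eventually_elim
      case (elim n)
      then obtain f where f: "inj_on f {..m}" "f ` {..m} \<subseteq> tips (G n) (g n)" by blast
      have "\<forall>i\<in>{..m}. \<exists>h. h \<in> G n \<and> h 0 = g n 0 \<and> h 1 = f i"
        using f(2) unfolding tips_def by fastforce
      then obtain h where h: "\<forall>i\<in>{..m}. h i \<in> G n \<and> h i 0 = g n 0 \<and> h i 1 = f i" by metis
      then have "inj_on (\<lambda>i. h i 1) {..m}" using f(1) by (simp add: inj_on_def)
      with h show ?case by blast
    qed
    \<comment> \<open>All m + 1 legs are chosen at once for each n; where this is impossible, each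
      of them is the filler.\<close>
    define h where "h = (\<lambda>n. if \<exists>h. ?Q n h then SOME h. ?Q n h else (\<lambda>_ _. basept (P n)))"
    have Q: "\<forall>\<^sub>F n in \<mu>. ?Q n (h n)"
      using ev
    proof eventually_elim
      case (elim n)
      then have "h n = (SOME h. ?Q n h)" by (simp add: h_def)
      then show ?case using someI_ex[OF elim] by simp
    qed
    have hG: "h n i \<in> insert (\<lambda>_. basept (P n)) (G n)" if "i \<in> {..m}" for n i
    proof (cases "\<exists>h. ?Q n h")
      case True
      then have "h n = (SOME h. ?Q n h)" by (simp add: h_def)
      then have "?Q n (h n)" using someI_ex[OF True] by simp
      then show ?thesis using that by blast
    next
      case False
      then show ?thesis unfolding h_def by (simp only: if_False insert_iff simp_thms)
    qed
    have hc: "(\<lambda>n. h n i) \<in> curve_seqs \<mu> P G z" if "i \<in> {..m}" for i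
    proof -
      \<comment> \<open>A common centre gives a common height, so these sequences share the level z
        of \<open>g\<close>.\<close>
      from Q gG have "\<forall>\<^sub>F n in \<mu>. h n i \<in> G n \<and> height (P n) (h n i) = 2 powi z"
        by eventually_elim (use that in \<open>auto simp: height_def\<close>)
      then show ?thesis using hG[OF that] by (simp add: curve_seqs_def)
    qed
    let ?f = "\<lambda>i. lim_curve \<mu> P (\<lambda>n. h n i) 1"
    have "inj_on ?f {..m}"
    proof (rule inj_onI, rule ccontr)
      fix i j assume ij: "i \<in> {..m}" "j \<in> {..m}" "?f i = ?f j" "i \<noteq> j"
      then have "\<forall>\<^sub>F n in \<mu>. h n i 1 = h n j 1"
        using lim_curve_tip_eq_iff[OF hc hc] by blast
      with Q have "\<forall>\<^sub>F n in \<mu>. False"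
        by eventually_elim (use ij in \<open>auto dest: inj_onD\<close>)
      then show False using \<mu> by (simp add: ultrafilter_def trivial_limit_def)
    qed
    moreover have "?f ` {..m} \<subseteq> tips lim_curves (lim_curve \<mu> P g)"
    proof
      fix x assume "x \<in> ?f ` {..m}"
      then obtain i where i: "i \<in> {..m}" "x = ?f i" by blast
      from Q have "\<forall>\<^sub>F n in \<mu>. h n i 0 = g n 0"
        by eventually_elim (use i in blast)
      then have "lim_curve \<mu> P (\<lambda>n. h n i) 0 = lim_curve \<mu> P g 0"
        using lim_curve_root_eq_iff[OF hc[OF i(1)] g] by blast
      then show "x \<in> tips lim_curves (lim_curve \<mu> P g)"
        using hc[OF i(1)] i(2) unfolding tips_def lim_curves_def by blast
    qed
    ultimately show "\<exists>f. inj_on f {..m} \<and> f ` {..m} \<subseteq> tips lim_curves (lim_curve \<mu> P g)"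
      by (intro exI[of _ ?f]) simp
  qed
  then show ?thesis
    unfolding ex_inj_on_atMost_iff ultrafilter_not_iff[OF \<mu>] by blast
qed

lemma card_tips_lim_curve:
  assumes g: "g \<in> curve_seqs \<mu> P G z" and "0 < t"
  shows "card (tips lim_curves (lim_curve \<mu> P g)) = t \<longleftrightarrow> (\<forall>\<^sub>F n in \<mu>. card (tips (G n) (g n)) = t)"
proof -
  \<comment> \<open>Having exactly t elements is expressed by the bounds t and t - 1, which are
    already understood in the limit. For t = 0 the two bounds would coincide.\<close>
  have card_eq: "card S = t \<longleftrightarrow> (finite S \<and> card S \<le> t) \<and> \<not> (finite S \<and> card S \<le> t - 1)" for S :: "'b set"
    using \<open>0 < t\<close> by (cases "finite S") auto
  have "(\<forall>\<^sub>F n in \<mu>. card (tips (G n) (g n)) = t) \<longleftrightarrow>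
     (\<forall>\<^sub>F n in \<mu>. finite (tips (G n) (g n)) \<and> card (tips (G n) (g n)) \<le> t) \<and>
     (\<forall>\<^sub>F n in \<mu>. \<not> (finite (tips (G n) (g n)) \<and> card (tips (G n) (g n)) \<le> t - 1))"
    by (subst card_eq) (rule eventually_conj_iff)
  also have "\<dots> \<longleftrightarrow> card (tips lim_curves (lim_curve \<mu> P g)) = t"
    by (simp only: tips_lim_curve[OF g, symmetric] ultrafilter_not_iff[OF \<mu>] card_eq)
  finally show ?thesis by (rule sym)
qed

lemma levels_ultralimit:
  assumes "0 < t"
  shows "z \<in> levels (ultralimit \<mu> P) lim_curves t \<longleftrightarrow> (\<forall>\<^sub>F n in \<mu>. z \<in> levels (P n) (G n) t)"
proof
  assume "z \<in> levels (ultralimit \<mu> P) lim_curves t"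
  then obtain g z' where g: "g \<in> curve_seqs \<mu> P G z'" "card (tips lim_curves (lim_curve \<mu> P g)) = t"
     "height (ultralimit \<mu> P) (lim_curve \<mu> P g) = 2 powi z"
    by (auto simp: levels_def lim_curves_def)
  then have "z' = z" using height_lim_curve[OF g(1)] by (simp add: two_powi_eq_iff)
  have "\<forall>\<^sub>F n in \<mu>. card (tips (G n) (g n)) = t"
    using card_tips_lim_curve[OF g(1) assms] g(2) by blast
  moreover have "\<forall>\<^sub>F n in \<mu>. g n \<in> G n \<and> height (P n) (g n) = 2 powi z"
    using g(1) \<open>z' = z\<close> by (simp add: curve_seqs_def)
  ultimately show "\<forall>\<^sub>F n in \<mu>. z \<in> levels (P n) (G n) t"
    by eventually_elim (auto simp: levels_def)
next
  let ?Q = "\<lambda>n g. g \<in> G n \<and> height (P n) g = 2 powi z \<and> card (tips (G n) g) = t"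
  assume ev: "\<forall>\<^sub>F n in \<mu>. z \<in> levels (P n) (G n) t"
  define g where "g = (\<lambda>n. if \<exists>g. ?Q n g then SOME g. ?Q n g else (\<lambda>_. basept (P n)))"
  have gQ: "?Q n (g n)" if "\<exists>g. ?Q n g" for n
    using someI_ex[OF that] that by (simp add: g_def)
  have Q: "\<forall>\<^sub>F n in \<mu>. ?Q n (g n)"
    using ev
  proof eventually_elim
    case (elim n)
    then have "\<exists>g. ?Q n g" by (auto simp: levels_def)
    then show ?case by (rule gQ)
  qed
  have "g n \<in> insert (\<lambda>_. basept (P n)) (G n)" for n
    by (cases "\<exists>g. ?Q n g") (use gQ[of n] in \<open>auto simp: g_def\<close>)
  with Q have g: "g \<in> curve_seqs \<mu> P G z"
    by (auto simp: curve_seqs_def elim: eventually_mono)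
  have "card (tips lim_curves (lim_curve \<mu> P g)) = t"
    unfolding card_tips_lim_curve[OF g assms] using Q by (auto elim: eventually_mono)
  then show "z \<in> levels (ultralimit \<mu> P) lim_curves t"
    using height_lim_curve[OF g] g by (auto simp: levels_def lim_curves_def)
qed

end

section \<open>Iterated cones of hedgehogs\<close>

lemma hedgehogs_transport:
  assumes H: "hedgehogs P G" and f: "inj_on f (mspace (pspace P))"
  shows "hedgehogs (transport f P) ((\<circ>) f ` G)" (is "hedgehogs ?T ?G")
    and "levels (transport f P) ((\<circ>) f ` G) t = levels P G t"
proof -
  have e: "basept P \<in> mspace (pspace P)"
    using hedgehogs_pointed[OF H] by (simp add: pointed_def)
  note M = hedgehogs_in_mspace[OF H]
  have height: "height ?T (f \<circ> g) = height P g" if "g \<in> G" for g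
    using mdist_transport[OF f e M[OF that, of 0]] by (simp add: height_def basept_transport[OF f])
  have eq: "f (g r) = f (g' s) \<longleftrightarrow> g r = g' s"
    if "g \<in> G" "g' \<in> G" "r \<in> {0..1}" "s \<in> {0..1}" for g g' r s
    using that M by (intro inj_on_eq_iff[OF f])
  show "hedgehogs ?T ?G"
    unfolding hedgehogs_def
  proof (intro conjI ballI)
    show "mspace (pspace ?T) = insert (basept ?T) (\<Union>g\<in>?G. g ` {0..1})"
      unfolding mspace_transport[OF f] basept_transport[OF f] hedgehogs_mspace[OF H] by auto
  next
    fix h assume "h \<in> ?G"
    then obtain g where g: "g \<in> G" "h = f \<circ> g" by blast
    then show "\<exists>z::int. \<forall>r\<in>{0..1}. mdist (pspace ?T) (basept ?T) (h r) = 2 powi z"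
      using hedgehogs_height_powi[OF H g(1)] hedgehogs_mdist_basept[OF H g(1)]
        mdist_transport[OF f e M[OF g(1)]] by (simp add: basept_transport[OF f])
  next
    fix h h' and r s :: real
    assume h: "h \<in> ?G" "h' \<in> ?G" and rs: "r \<in> {0..1}" "s \<in> {0..1}"
    obtain g where g: "g \<in> G" "h = f \<circ> g" using h(1) by blast
    obtain g' where g': "g' \<in> G" "h' = f \<circ> g'" using h(2) by blast
    show "mdist (pspace ?T) (h r) (h' s) =
        (if h 1 = h' 1 then height ?T h * \<bar>r - s\<bar> / 4
         else if h 0 = h' 0 then height ?T h * (r + s) / 4
         else max (height ?T h) (height ?T h'))"
      unfolding g(2) g'(2) height[OF g(1)] height[OF g'(1)] comp_apply
        mdist_transport[OF f M[OF g(1) rs(1)] M[OF g'(1) rs(2)]] hedgehogs_mdist[OF H g(1) g'(1) rs]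
      using eq[OF g(1) g'(1), of 0 0] eq[OF g(1) g'(1), of 1 1] by simp
  qed
  have "tips ?G (f \<circ> g) = f ` tips G g" if "g \<in> G" for g
  proof -
    have "f (g' 0) = f (g 0) \<longleftrightarrow> g' 0 = g 0" if "g' \<in> G" for g'
      using eq[OF that \<open>g \<in> G\<close>, of 0 0] by simp
    then show ?thesis by (fastforce simp: tips_def)
  qed
  moreover have "card (f ` tips G g) = card (tips G g)" for g
    using M[of _ 1] by (intro card_image inj_on_subset[OF f]) (auto simp: tips_def)
  ultimately show "levels ?T ?G t = levels P G t"
    using height by (auto simp: levels_def)
qed

text \<open>Dividing the metric by \<open>2 powi k\<close> lowers every level by k and keeps heights
  powers of two; this is why the scaling factors are powers of two.\<close>

lemma hedgehogs_rescale:
  assumes H: "hedgehogs P G"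
  shows "hedgehogs (rescale (2 powi k) (pspace P), basept P) G" (is "hedgehogs ?R G")
    and "z \<in> levels (rescale (2 powi k) (pspace P), basept P) G t \<longleftrightarrow> z + k \<in> levels P G t"
proof -
  have pos: "(0::real) < 2 powi k" by (simp add: zero_less_power_int)
  have height: "height ?R g = height P g / 2 powi k" for g
    by (simp add: height_def pos)
  have "mdist (pspace ?R) (basept ?R) (g r) = height P g / 2 powi k"
    if "g \<in> G" "r \<in> {0..1}" for g r
    using hedgehogs_mdist_basept[OF H that] by (simp add: pos)
  moreover have "\<exists>z'::int. height P g / 2 powi k = 2 powi z'" if "g \<in> G" for g
    using hedgehogs_height_powi[OF H that] by (metis power_int_diff zero_neq_numeral)
  moreover have "mdist (pspace ?R) (g r) (g' s) =
        (if g 1 = g' 1 then height ?R g * \<bar>r - s\<bar> / 4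
         else if g 0 = g' 0 then height ?R g * (r + s) / 4
         else max (height ?R g) (height ?R g'))"
    if "g \<in> G" "g' \<in> G" "r \<in> {0..1}" "s \<in> {0..1}" for g g' r s
    using hedgehogs_mdist[OF H that] pos
    by (simp add: height max_divide_distrib_right)
  ultimately show "hedgehogs ?R G"
    unfolding hedgehogs_def using hedgehogs_mspace[OF H] pos by simp
  have "height P g / 2 powi k = 2 powi z \<longleftrightarrow> height P g = 2 powi (z + k)" for g
    using pos by (simp add: power_int_add field_simps)
  then show "z \<in> levels ?R G t \<longleftrightarrow> z + k \<in> levels P G t"
    by (simp add: levels_def height)
qed

lemma small_ordinal_induct [case_names zero Suc limit]:
  assumes "R 0 0" "\<And>k n. R k n \<Longrightarrow> R k (Suc n)" "\<And>k. (\<And>n. R k n) \<Longrightarrow> R (Suc k) 0"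
  shows "R (k::nat) (n::nat)"
proof (induction k arbitrary: n)
  case 0
  show ?case by (induction n) (use assms in auto)
next
  case (Suc k)
  show ?case by (induction n) (use assms Suc in auto)
qed

text \<open>The trace of \<open>iter_cone\<close> on levels: dividing by \<open>2 ^ 3 ^ m\<close>
  turns the question about z into one about \<open>z + 3 ^ m\<close>, whereas a limit stage takes an
  ultralimit without rescaling.\<close>

fun iter_levels :: "nat filter \<Rightarrow> int set \<Rightarrow> nat \<Rightarrow> nat \<Rightarrow> int set" where
  "iter_levels \<mu> A 0 0 = A"
| "iter_levels \<mu> A k (Suc n) = {z. \<forall>\<^sub>F m in \<mu>. z + 3 ^ m \<in> iter_levels \<mu> A k n}"
| "iter_levels \<mu> A (Suc k) 0 = {z. \<forall>\<^sub>F n in \<mu>. z \<in> iter_levels \<mu> A k n}"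

lemma hedgehogs_encoded_ultralimit:
  assumes "ultrafilter \<mu>" and "\<And>n. hedgehogs (P n) (G n)"
  shows "\<exists>G'. hedgehogs (transport encode_class (ultralimit \<mu> P)) G' \<and>
    (\<forall>t>0. levels (transport encode_class (ultralimit \<mu> P)) G' t = {z. \<forall>\<^sub>F n in \<mu>. z \<in> levels (P n) (G n) t})"
proof -
  note H = hedgehogs_ultralimit[of \<mu> P G, OF assms]
  have "inj_on encode_class (mspace (pspace (ultralimit \<mu> P)))"
    using assms hedgehogs_pointed by (intro inj_on_encode_class_ultralimit) blast+
  note T = hedgehogs_transport[OF H this]
  show ?thesis
    using T(1) by (intro exI conjI) (auto simp: T(2) levels_ultralimit[of \<mu> P G, OF assms])
qed

lemma hedgehogs_iter_cone:
  assumes "ultrafilter \<mu>" "hedgehogs P G"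
  shows "\<exists>G'. hedgehogs (iter_cone \<mu> (\<lambda>m. 2 ^ 3 ^ m) P k n) G' \<and>
    (\<forall>t>0. levels (iter_cone \<mu> (\<lambda>m. 2 ^ 3 ^ m) P k n) G' t = iter_levels \<mu> (levels P G t) k n)"
proof (induction k n rule: small_ordinal_induct)
  case zero
  have "inj_on Point (mspace (pspace P))" by (simp add: inj_on_def)
  note T = hedgehogs_transport[OF assms(2) this]
  show ?case using T(1) by (intro exI conjI) (auto simp: T(2))
next
  case (Suc k n)
  let ?Q = "iter_cone \<mu> (\<lambda>m. 2 ^ 3 ^ m) P k n"
  obtain G' where G': "hedgehogs ?Q G'"
      "\<And>t. 0 < t \<Longrightarrow> levels ?Q G' t = iter_levels \<mu> (levels P G t) k n"
    using Suc by blast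
  have "2 ^ 3 ^ m = (2::real) powi (3 ^ m)" for m :: nat
    using power_int_of_nat[of "2::real" "3 ^ m"] by simp
  then have "hedgehogs (rescale (2 ^ 3 ^ m) (pspace ?Q), basept ?Q) G'"
     "z \<in> levels (rescale (2 ^ 3 ^ m) (pspace ?Q), basept ?Q) G' t \<longleftrightarrow> z + 3 ^ m \<in> levels ?Q G' t"
     for m t and z :: int
    using hedgehogs_rescale(1)[OF G'(1), of "3 ^ m"]
      hedgehogs_rescale(2)[OF G'(1), where k = "3 ^ m" and z = z and t = t] by simp_all
  then show ?case
    using hedgehogs_encoded_ultralimit[OF assms(1), of "\<lambda>m. (rescale (2 ^ 3 ^ m) (pspace ?Q), basept ?Q)" "\<lambda>_. G'"]
    by (simp add: asymp_cone_def G'(2))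
next
  case (limit k)
  let ?Q = "iter_cone \<mu> (\<lambda>m. 2 ^ 3 ^ m) P k"
  have "\<exists>G'. hedgehogs (?Q n) G' \<and> (\<forall>t>0. levels (?Q n) G' t = iter_levels \<mu> (levels P G t) k n)" for n
    using limit by blast
  then obtain G' where "hedgehogs (?Q n) (G' n)"
     "\<forall>t>0. levels (?Q n) (G' n) t = iter_levels \<mu> (levels P G t) k n" for n
    by metis
  then show ?case
    using hedgehogs_encoded_ultralimit[OF assms(1), of ?Q G'] by simp
qed

section \<open>A topological invariant\<close>

text \<open>Keeping the set of counts asks only which counts occur, not how often. A component with
  infinitely many non-cut points contributes 0.\<close>

definition noncut_counts :: "'a topology \<Rightarrow> nat set" where
  "noncut_counts X = (\<lambda>C. card {p \<in> C. connectedin X (C - {p})}) ` connected_components_of X"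

lemma noncut_counts_homeomorphic:
  assumes "X homeomorphic_space Y"
  shows "noncut_counts X = noncut_counts Y"
proof -
  obtain f where f: "homeomorphic_map X Y f"
    using assms unfolding homeomorphic_space by blast
  have "card {q \<in> f ` C. connectedin Y (f ` C - {q})} = card {p \<in> C. connectedin X (C - {p})}"
    if C: "C \<in> connected_components_of X" for C
  proof -
    have CX: "C \<subseteq> topspace X" using C by (rule connected_components_of_subset)
    have inj: "inj_on f C" using homeomorphic_imp_injective_map[OF f] CX by (rule inj_on_subset)
    have "connectedin Y (f ` C - {f p}) \<longleftrightarrow> connectedin X (C - {p})" if "p \<in> C" for p
    proof -
      have "f ` C - {f p} = f ` (C - {p})"
        using inj that by (auto dest: inj_onD)
      then show ?thesis
        using homeomorphic_map_connectedness[OF f, of "C - {p}"] CX by auto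
    qed
    then have "{q \<in> f ` C. connectedin Y (f ` C - {q})} = f ` {p \<in> C. connectedin X (C - {p})}"
      by auto
    then show ?thesis
      by (simp add: card_image inj_on_subset[OF inj])
  qed
  then show ?thesis
    unfolding noncut_counts_def homeomorphic_map_connected_components_of[OF f] image_image
    by (intro image_cong) auto
qed

text \<open>Intermediate value theorem for the distance from a point. Every proof of
  disconnectedness below exhibits a distance that is skipped.\<close>

lemma connectedin_mdist_intermediate:
  assumes S: "connectedin (mtopology_of m) S" and a: "a \<in> mspace m" and x: "x \<in> S" and y: "y \<in> S"
    and c: "mdist m a x < c" "c < mdist m a y"
  shows "\<exists>z\<in>S. mdist m a z = c"
proof -
  have "connectedin euclidean (mdist m a ` S)"
    using S continuous_on_mdist[OF a] by (rule connectedin_continuous_map_image[rotated])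
  then have "connected (mdist m a ` S)" by simp
  then have "c \<in> mdist m a ` S"
    by (rule connectedD_interval[where x = "mdist m a x" and y = "mdist m a y"]) (use x y c in auto)
  then show ?thesis by auto
qed

section \<open>Connected components and cut points of a space of hedgehogs\<close>

definition cluster :: "(real \<Rightarrow> 'a) set \<Rightarrow> (real \<Rightarrow> 'a) \<Rightarrow> 'a set" where
  "cluster G g = (\<Union>g'\<in>{g'\<in>G. g' 0 = g 0}. g' ` {0..1})"

lemma clusterE:
  assumes "x \<in> cluster G g"
  obtains g' r where "g' \<in> G" "g' 0 = g 0" "r \<in> {0..1}" "x = g' r"
  using assms unfolding cluster_def by blast

lemma clusterI: "g' \<in> G \<Longrightarrow> g' 0 = g 0 \<Longrightarrow> r \<in> {0..1} \<Longrightarrow> g' r \<in> cluster G g"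
  unfolding cluster_def by blast

context
  fixes P :: "'a pointed_metric" and G :: "(real \<Rightarrow> 'a) set"
  assumes H: "hedgehogs P G"
begin

private abbreviation "X \<equiv> mtopology_of (pspace P)"

lemma mdist_in_cluster:
  assumes "g \<in> G" "g' \<in> G" "g' 0 = g 0" "r \<in> {0..1}" "s \<in> {0..1}"
  shows "mdist (pspace P) (g r) (g' s) =
    height P g / 4 * (if g' 1 = g 1 then \<bar>r - s\<bar> else r + s)"
  using hedgehogs_mdist[OF H assms(1,2,4,5)] assms(3) by simp

text \<open>Along one leg the distance is a constant times the difference of the parameters, so the
  leg is a Lipschitz image of [0, 1].\<close>

lemma connectedin_curve:
  assumes "g \<in> G" "connected S" "S \<subseteq> {0..1}"
  shows "connectedin X (g ` S)"
proof -
  have "Lipschitz_continuous_map (submetric euclidean_metric {0..1}) (pspace P) g"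
    unfolding Lipschitz_continuous_map_def
  proof (intro conjI exI ballI)
    show "g \<in> mspace (submetric euclidean_metric {0..1}) \<rightarrow> mspace (pspace P)"
      using hedgehogs_in_mspace[OF H assms(1)] by auto
    fix r s :: real
    assume "r \<in> mspace (submetric euclidean_metric {0..1})" "s \<in> mspace (submetric euclidean_metric {0..1})"
    then show "mdist (pspace P) (g r) (g s)
        \<le> height P g / 4 * mdist (submetric euclidean_metric {0..1}) r s"
      using mdist_in_cluster[OF assms(1) assms(1)] by (simp add: dist_real_def)
  qed
  then have "continuous_map (top_of_set {0..1}) X g"
    using Lipschitz_continuous_imp_continuous_map by (force simp: mtopology_of_submetric)
  moreover have "connectedin (top_of_set {0..1}) S"
    using assms(2,3) by (simp add: connectedin_subtopology)
  ultimately show ?thesis by (rule connectedin_continuous_map_image)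
qed

lemma connectedin_cluster:
  assumes "g \<in> G"
  shows "connectedin X (cluster G g)"
  unfolding cluster_def
proof (rule connectedin_Union)
  show "\<Inter> ((\<lambda>g'. g' ` {0..1}) ` {g' \<in> G. g' 0 = g 0}) \<noteq> {}"
  proof -
    have "g 0 \<in> \<Inter> ((\<lambda>g'. g' ` {0..1}) ` {g' \<in> G. g' 0 = g 0})"
      by (force intro: rev_image_eqI[of 0])
    then show ?thesis by blast
  qed
qed (auto intro: connectedin_curve)

text \<open>The factor 1 / 4 in \<open>hedgehogs\<close> leaves a gap: seen from the centre of a
  star of height h, the star lies within distance h / 4 and all other points at distance h or more.
  A connected set cannot cross this gap.\<close>

lemma connected_meets_cluster_subset:
  assumes g: "g \<in> G" and S: "connectedin X S" and "S \<inter> cluster G g \<noteq> {}"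
  shows "S \<subseteq> cluster G g"
proof (rule ccontr)
  let ?h = "height P g"
  have h: "?h > 0" using hedgehogs_height_pos[OF H g] .
  have near: "mdist (pspace P) (g 0) q \<le> ?h / 4" if q: "q \<in> cluster G g" for q
  proof -
    obtain g' s where "g' \<in> G" "g' 0 = g 0" "s \<in> {0..1}" "q = g' s"
      using q by (rule clusterE)
    then show ?thesis using mdist_in_cluster[OF g, of g' 0 s] h by (auto simp: field_simps)
  qed
  have far: "?h \<le> mdist (pspace P) (g 0) q" if q: "q \<in> mspace (pspace P)" "q \<notin> cluster G g" for q
  proof (cases "q = basept P")
    case True
    then show ?thesis by (simp add: height_def mdist_commute)
  next
    case False
    then obtain g' s where g': "g' \<in> G" "s \<in> {0..1}" "q = g' s"
      using q(1) hedgehogs_mspace[OF H] by auto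
    have "g' 0 \<noteq> g 0" using q(2) clusterI[OF g'(1) _ g'(2)] g'(3) by metis
    moreover have "g 1 \<noteq> g' 1"
      using hedgehogs_same_tip[OF H g g'(1), of 0] \<open>g' 0 \<noteq> g 0\<close> by auto
    ultimately show ?thesis
      using hedgehogs_mdist[OF H g g'(1), of 0 s] g'(2,3) by simp
  qed
  assume "\<not> S \<subseteq> cluster G g"
  then obtain y where y: "y \<in> S" "y \<notin> cluster G g" by blast
  obtain x where x: "x \<in> S" "x \<in> cluster G g" using assms(3) by blast
  have SM: "S \<subseteq> mspace (pspace P)" using connectedin_subset_topspace[OF S] by simp
  \<comment> \<open>no point of the space is at a distance strictly between \<open>?h / 4\<close> and \<open>?h\<close> from \<open>g 0\<close>\<close>
  have "\<exists>q\<in>S. mdist (pspace P) (g 0) q = ?h / 2"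
    using near[OF x(2)] far[of y] y SM h hedgehogs_in_mspace[OF H g, of 0]
    by (intro connectedin_mdist_intermediate[OF S _ x(1) y(1)]) auto
  then show False using near far SM h by fastforce
qed

lemma connected_component_eq_cluster:
  assumes "g \<in> G" "C \<in> connected_components_of X" "C \<inter> cluster G g \<noteq> {}"
  shows "C = cluster G g"
proof
  show "C \<subseteq> cluster G g"
    using assms by (intro connected_meets_cluster_subset connectedin_connected_components_of)
  show "cluster G g \<subseteq> C"
    using assms by (intro connected_components_of_maximal[OF assms(2)] connectedin_cluster)
      (auto simp: disjnt_def)
qed

lemma connected_components_of_hedgehogs:
  "connected_components_of X \<subseteq> insert {basept P} (cluster G ` G)"
  "cluster G ` G \<subseteq> connected_components_of X"
proof -
  show "connected_components_of X \<subseteq> insert {basept P} (cluster G ` G)"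
  proof
    fix C assume C: "C \<in> connected_components_of X"
    show "C \<in> insert {basept P} (cluster G ` G)"
    proof (cases "\<exists>g\<in>G. C \<inter> cluster G g \<noteq> {}")
      case True
      then show ?thesis using connected_component_eq_cluster[OF _ C] by blast
    next
      case False
      have "C \<subseteq> insert (basept P) (\<Union>g\<in>G. g ` {0..1})"
        using connected_components_of_subset[OF C] hedgehogs_mspace[OF H] by simp
      moreover have "g ` {0..1} \<subseteq> cluster G g" if "g \<in> G" for g
        using that by (auto intro: clusterI)
      ultimately have "C \<subseteq> {basept P}" using False by fastforce
      then show ?thesis using nonempty_connected_components_of[OF C] by blast
    qed
  qed
  show "cluster G ` G \<subseteq> connected_components_of X"
  proof
    fix C assume "C \<in> cluster G ` G"
    then obtain g where g: "g \<in> G" "C = cluster G g" by blast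
    have g0: "g 0 \<in> mspace (pspace P)" using hedgehogs_in_mspace[OF H g(1), of 0] by simp
    then have *: "connected_component_of_set X (g 0) \<in> connected_components_of X"
      by (simp add: connected_component_in_connected_components_of)
    have "g 0 \<in> connected_component_of_set X (g 0)" "g 0 \<in> cluster G g"
      using g0 clusterI[OF g(1), of g 0] by (simp_all add: connected_component_of_refl)
    then have "connected_component_of_set X (g 0) = C"
      unfolding g(2) by (intro connected_component_eq_cluster[OF g(1) *]) blast
    with * show "C \<in> connected_components_of X" by simp
  qed
qed

text \<open>Deleting a tip leaves a half-open leg; this and the other legs are connected and still
  meet in the centre.\<close>

lemma cluster_minus_tip_connected:
  assumes g: "g \<in> G" and p: "p \<in> tips G g"
  shows "connectedin X (cluster G g - {p})"
proof -
  obtain g' where g': "g' \<in> G" "g' 0 = g 0" "p = g' 1"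
    using p by (auto simp: tips_def)
  have h: "height P g' > 0" using hedgehogs_height_pos[OF H g'(1)] .
  let ?U = "insert (g' ` {0..<1}) ((\<lambda>k. k ` {0..1}) ` {k \<in> G. k 0 = g 0 \<and> k 1 \<noteq> p})"
  have ne: "k r \<noteq> p" if k: "k \<in> G" "k 0 = g 0" "r \<in> {0..1}" "k 1 \<noteq> p \<or> r \<noteq> 1" for k r
  proof -
    have "mdist (pspace P) (g' 1) (k r) \<noteq> 0"
      using mdist_in_cluster[OF g'(1) k(1), of 1 r] k g' h by (auto split: if_splits)
    moreover have "p \<in> mspace (pspace P)"
      using hedgehogs_in_mspace[OF H g'(1), of 1] g'(3) by simp
    ultimately show ?thesis using g'(3) by auto
  qed
  have "cluster G g - {p} = \<Union>?U"
  proof (intro equalityI subsetI)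
    fix x assume "x \<in> cluster G g - {p}"
    then obtain k r where k: "k \<in> G" "k 0 = g 0" "r \<in> {0..1}" "x = k r" "x \<noteq> p"
      by (auto elim: clusterE)
    show "x \<in> \<Union>?U"
    proof (cases "k 1 = p")
      case True
      then have "r \<noteq> 1" using k by auto
      moreover have "k r = g' r"
        using hedgehogs_same_tip[OF H k(1) g'(1)] True g'(3) k(3) by simp
      ultimately have "x \<in> g' ` {0..<1}" using k(3,4) by auto
      then show ?thesis by blast
    qed (use k in blast)
  next
    fix x assume x: "x \<in> \<Union>?U"
    obtain k r where k: "k \<in> G" "k 0 = g 0" "r \<in> {0..1}" "k 1 \<noteq> p \<or> r \<noteq> 1" "x = k r"
    proof (cases "x \<in> g' ` {0..<1}")
      case True
      then obtain r where "r \<in> {0..<1}" "x = g' r" by blast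
      then show ?thesis using that[of g' r] g' by simp
    next
      case False
      then show ?thesis using x that by blast
    qed
    then show "x \<in> cluster G g - {p}" using ne[OF k(1-4)] clusterI[of k G g r] k by simp
  qed
  moreover have "connectedin X (\<Union>?U)"
  proof (rule connectedin_Union)
    have "g 0 \<in> \<Inter>?U"
      using g'(2) by (force intro: rev_image_eqI[of 0])
    then show "\<Inter>?U \<noteq> {}" by blast
  next
    fix S assume "S \<in> ?U"
    then show "connectedin X S" using g'(1) by (auto intro!: connectedin_curve)
  qed
  ultimately show ?thesis by simp
qed

text \<open>Such a point is alone in the star at its distance from the tip of its leg, so its
  removal skips a distance with star points on both sides. The last hypothesis excludes the centre
  of a one-legged star, an end point of an arc, since nothing is farther from the tip.\<close>

lemma cluster_minus_interior_disconnected: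
  assumes g: "g \<in> G" and g': "g' \<in> G" "g' 0 = g 0" and r: "0 \<le> r" "r < 1"
    and "0 < r \<or> tips G g \<noteq> {g' 1}"
  shows "\<not> connectedin X (cluster G g - {g' r})"
proof
  let ?d = "mdist (pspace P) (g' 1)"
  let ?c = "height P g' / 4 * (1 - r)"
  assume conn: "connectedin X (cluster G g - {g' r})"
  have h: "height P g' > 0" using hedgehogs_height_pos[OF H g'(1)] .
  have d: "?d (k s) = height P g' / 4 * (if k 1 = g' 1 then 1 - s else 1 + s)"
    if "k \<in> G" "k 0 = g 0" "s \<in> {0..1}" for k s
    using mdist_in_cluster[OF g'(1) that(1), of 1 s] that g'(2) by simp
  \<comment> \<open>\<open>g' r\<close> is the only point of the cluster at its distance from the tip \<open>g' 1\<close>\<close>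
  have only: "x = g' r" if x: "x \<in> cluster G g" "?d x = ?c" for x
  proof -
    obtain k s where k: "k \<in> G" "k 0 = g 0" "s \<in> {0..1}" "x = k s"
      using x(1) by (rule clusterE)
    have eq: "(if k 1 = g' 1 then 1 - s else 1 + s) = 1 - r"
      using d[OF k(1-3)] x(2) k(4) h by simp
    show ?thesis
    proof (cases "k 1 = g' 1")
      case True
      then show ?thesis using eq k hedgehogs_same_tip[OF H k(1) g'(1), of s] by simp
    next
      case False
      then have "s = 0" "r = 0" using eq k(3) r by auto
      then show ?thesis using k g'(2) by simp
    qed
  qed
  have "?d (g' 1) = 0" using d[OF g', of 1] by simp
  moreover have "0 < ?c" using h r by simp
  moreover have "?d (g' r) = ?c" using d[OF g', of r] r by simp
  moreover have "g' 1 \<in> cluster G g" using clusterI[of g' G g 1] g' by simp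
  ultimately have near: "g' 1 \<in> cluster G g - {g' r}" "?d (g' 1) < ?c"
    by auto
  \<comment> \<open>For r > 0 the centre is farther from \<open>g' 1\<close> than
    \<open>g' r\<close> is; for r = 0 the tip of another leg is.\<close>
  have "\<exists>y. y \<in> cluster G g \<and> ?c < ?d y"
  proof (cases "0 < r")
    case True
    have "?d (g' 0) = height P g' / 4" using d[OF g', of 0] by simp
    then show ?thesis using clusterI[of g' G g 0] g' True h by (intro exI[of _ "g' 0"]) simp
  next
    case False
    then have "tips G g \<noteq> {g' 1}" using assms(6) by blast
    moreover have "g' 1 \<in> tips G g" using g' by (auto simp: tips_def)
    ultimately obtain k where k: "k \<in> G" "k 0 = g 0" "k 1 \<noteq> g' 1"
      by (auto simp: tips_def)
    then show ?thesis
      using d[OF k(1,2), of 1] clusterI[of k G g 1] k h r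
      by (intro exI[of _ "k 1"]) (simp add: field_simps, smt (verit) mult_nonneg_nonneg)
  qed
  then obtain y where y: "y \<in> cluster G g - {g' r}" "?c < ?d y"
    using \<open>?d (g' r) = ?c\<close> by (metis DiffI less_irrefl singletonD)
  have "\<exists>z\<in>cluster G g - {g' r}. ?d z = ?c"
    using hedgehogs_in_mspace[OF H g'(1), of 1] near y
    by (intro connectedin_mdist_intermediate[OF conn]) auto
  then show False using only by blast
qed

text \<open>The non-cut points are the tips, except that a one-legged star is an arc whose centre
  may be counted as well. Its count is still at most 2, so from 3 on the number of legs is read off
  correctly.\<close>

lemma card_noncut_cluster:
  assumes g: "g \<in> G" and t: "3 \<le> t"
  shows "card {p \<in> cluster G g. connectedin X (cluster G g - {p})} = t \<longleftrightarrow> card (tips G g) = t"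
proof -
  let ?E = "{p \<in> cluster G g. connectedin X (cluster G g - {p})}"
  have tips_E: "tips G g \<subseteq> ?E"
    using cluster_minus_tip_connected[OF g] by (auto simp: tips_def intro!: clusterI)
  have E: "p \<in> tips G g \<or> p = g 0 \<and> (\<exists>g'\<in>G. tips G g = {g' 1})" if p: "p \<in> ?E" for p
  proof -
    have "p \<in> cluster G g" using p by blast
    then obtain g' r where g': "g' \<in> G" "g' 0 = g 0" "r \<in> {0..1}" "p = g' r"
      by (rule clusterE)
    show ?thesis
    proof (cases "r = 1")
      case True
      then show ?thesis using g' by (auto simp: tips_def)
    next
      case False
      then have "\<not> (0 < r \<or> tips G g \<noteq> {g' 1})"
        using cluster_minus_interior_disconnected[OF g g'(1,2), of r] p g'(3,4) by auto
      then have "r = 0" "tips G g = {g' 1}" using g'(3) by auto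
      then show ?thesis using g' by auto
    qed
  qed
  show ?thesis
  proof (cases "\<exists>g'\<in>G. tips G g = {g' 1}")
    case True
    then obtain x where x: "tips G g = {x}" by blast
    then have "?E \<subseteq> {x, g 0}" using E by blast
    then have "card ?E \<le> card {x, g 0}" by (intro card_mono) auto
    also have "\<dots> \<le> 2" by (cases "x = g 0") auto
    finally show ?thesis using x t by simp
  next
    case False
    then have "?E = tips G g" using E tips_E by blast
    then show ?thesis by simp
  qed
qed

lemma noncut_counts_hedgehogs:
  assumes "3 \<le> t"
  shows "t \<in> noncut_counts (mtopology_of (pspace P)) \<longleftrightarrow> levels P G t \<noteq> {}"
proof
  assume "t \<in> noncut_counts X"
  then obtain C where C: "C \<in> connected_components_of X" "card {p \<in> C. connectedin X (C - {p})} = t"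
    by (auto simp: noncut_counts_def)
  \<comment> \<open>The basepoint alone has a count of at most 1 and cannot be mistaken for a star
    with t legs.\<close>
  have "C \<noteq> {basept P}"
  proof
    assume "C = {basept P}"
    then have "card {p \<in> C. connectedin X (C - {p})} \<le> card {basept P}"
      by (intro card_mono) auto
    then show False using C(2) assms by simp
  qed
  then obtain g where g: "g \<in> G" "C = cluster G g"
    using C(1) connected_components_of_hedgehogs(1) by blast
  then have "card (tips G g) = t" using card_noncut_cluster[OF g(1) assms] C(2) by simp
  moreover obtain z :: int where "height P g = 2 powi z"
    using hedgehogs_height_powi[OF H g(1)] by blast
  ultimately show "levels P G t \<noteq> {}" using g(1) by (auto simp: levels_def)
next
  assume "levels P G t \<noteq> {}"
  then obtain g where g: "g \<in> G" "card (tips G g) = t" by (auto simp: levels_def)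
  then have "card {p \<in> cluster G g. connectedin X (cluster G g - {p})} = t"
    using card_noncut_cluster[OF g(1) assms] by blast
  moreover have "cluster G g \<in> connected_components_of X"
    using connected_components_of_hedgehogs(2) g(1) by blast
  ultimately show "t \<in> noncut_counts X"
    unfolding noncut_counts_def by blast
qed

end

section \<open>Counting down ordinals along ternary expansions\<close>

text \<open>The second rule follows the sequence of the \<omega> a + n, which converges to \<omega>
  (a + 1), taking the number read as the index. At \<open>(0, 0)\<close> no rule applies and the
  countdown ends.\<close>

inductive descend :: "small_ordinal \<Rightarrow> nat \<Rightarrow> small_ordinal \<Rightarrow> bool" where
  "descend (a, Suc b) n (a, b)"
| "descend (Suc a, 0) n (a, n)"

text \<open>\<open>residue l z m \<rho>\<close>: counting down from \<open>l\<close> along the ternary digits of \<open>z\<close>, all at positions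
  below \<open>m\<close> and read from the lowest one upwards, leaves \<open>\<rho>\<close>. The derivative removes the highest
  digit.\<close>

inductive residue :: "small_ordinal \<Rightarrow> int \<Rightarrow> nat \<Rightarrow> small_ordinal \<Rightarrow> bool" for l where
  start: "residue l 0 0 l"
| step: "residue l z m \<rho> \<Longrightarrow> m \<le> n \<Longrightarrow> descend \<rho> n \<rho>' \<Longrightarrow> residue l (z + 3 ^ n) (Suc n) \<rho>'"

section \<open>Uniqueness of the countdown and of the ternary digits\<close>

lemma ord_less_iff: "ord_less (a, b) (c, d) \<longleftrightarrow> a < c \<or> a = c \<and> b < d"
  by (auto simp: ord_less_def)

lemma descend_less: "descend \<rho> n \<rho>' \<Longrightarrow> ord_less \<rho>' \<rho>"
  by (induction rule: descend.induct) (auto simp: ord_less_iff)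

lemma descend_unique: "descend \<rho> n \<rho>1 \<Longrightarrow> descend \<rho> n \<rho>2 \<Longrightarrow> \<rho>1 = \<rho>2"
  by (auto elim!: descend.cases)

text \<open>Distinct powers of 3 with exponents below m sum to at most (3 ^ m - 1) / 2, so a further
  digit outweighs all the earlier ones.\<close>

lemma residue_bounds: "residue l z m \<rho> \<Longrightarrow> 0 \<le> z \<and> 2 * z < 3 ^ m"
proof (induction rule: residue.induct)
  case (step z m \<rho> n \<rho>')
  have "(3::int) ^ m \<le> 3 ^ n" using step.hyps(2) by (simp add: power_increasing)
  moreover have "2 * z < 3 ^ m" using step.IH by simp
  ultimately have "2 * z < 3 ^ n" by linarith
  then show ?case using step.IH by simp
qed simp

lemma residue_le: "residue l z m \<rho> \<Longrightarrow> \<not> ord_less l \<rho>"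
proof (induction rule: residue.induct)
  case (step z m \<rho> n \<rho>')
  with descend_less[OF step.hyps(3)] show ?case
    by (cases l; cases \<rho>; cases \<rho>') (auto simp: ord_less_iff)
qed (cases l, simp add: ord_less_iff)

text \<open>The left side of the equation lies strictly between 3 ^ n / 2 and 3 ^ (n + 1) / 2, the
  right side between the same bounds for p, and these intervals are disjoint for different
  exponents. Here z may be negative, since a derivative tests all integers.\<close>

lemma base3_leading_unique:
  fixes x z :: int
  assumes "0 \<le> x" "2 * x < 3 ^ p" "2 * \<bar>z\<bar> < 3 ^ n" "z + 3 ^ n = x + 3 ^ p"
  shows "n = p \<and> z = x"
proof -
  have "\<not> p < n"
  proof
    assume "p < n"
    then have "(3::int) ^ Suc p \<le> 3 ^ n" by (intro power_increasing) auto
    then show False using assms unfolding power_Suc by linarith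
  qed
  moreover have "\<not> n < p"
  proof
    assume "n < p"
    then have "(3::int) ^ Suc n \<le> 3 ^ p" by (intro power_increasing) auto
    then show False using assms unfolding power_Suc by linarith
  qed
  ultimately show ?thesis using assms(4) by (simp add: not_less)
qed

text \<open>By size, the highest digit of \<open>z + 3 ^ n\<close> is at position n. So adding a
  large power of 3 to an integer gives a coded level only if the integer is itself one.\<close>

lemma residue_add_power:
  assumes "residue l (z + 3 ^ n) m' \<rho>'" "2 * \<bar>z\<bar> < 3 ^ n"
  shows "m' = Suc n \<and> (\<exists>m \<rho>. residue l z m \<rho> \<and> descend \<rho> n \<rho>')"
  using assms(1)
proof cases
  case start
  then show ?thesis using assms(2) by simp
next
  case (step x m \<rho> p)
  have "(3::int) ^ m \<le> 3 ^ p" using step by (simp add: power_increasing)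
  moreover have "2 * x < 3 ^ m" using residue_bounds[OF step(3)] by simp
  ultimately have "2 * x < 3 ^ p" by linarith
  then have "n = p \<and> z = x"
    using residue_bounds[OF step(3)] step assms(2) by (intro base3_leading_unique) auto
  then show ?thesis using step by blast
qed

text \<open>Two expansions of one number have the same highest digit, and \<open>descend\<close> is
  deterministic. At limit stages this keeps the residue of a level from varying with n.\<close>

lemma residue_unique:
  "residue l z m \<rho> \<Longrightarrow> residue l z m' \<rho>' \<Longrightarrow> m = m' \<and> \<rho> = \<rho>'"
proof (induction arbitrary: m' \<rho>' rule: residue.induct)
  case start
  then show ?case
  proof cases
    case (step z m \<rho> n)
    moreover have "0 \<le> z" using residue_bounds[OF step(3)] by simp
    moreover have "(0::int) < 3 ^ n" by simp
    ultimately show ?thesis by linarith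
  qed simp
next
  case (step z m \<rho> n \<rho>1)
  have "(3::int) ^ m \<le> 3 ^ n" using step.hyps(2) by (simp add: power_increasing)
  moreover have "2 * \<bar>z\<bar> < 3 ^ m" using residue_bounds[OF step.hyps(1)] by simp
  ultimately have "2 * \<bar>z\<bar> < 3 ^ n" by linarith
  then obtain k \<sigma> where "m' = Suc n" "residue l z k \<sigma>" "descend \<sigma> n \<rho>'"
    using residue_add_power[OF step.prems] by blast
  then show ?case using step.IH step.hyps(3) descend_unique by blast
qed

text \<open>A derivative restores the residue before the last digit, which is strictly larger;
  conversely, a residue of at least \<open>(a, Suc b)\<close> is lowered by any large digit to one
  of at least \<open>(a, b)\<close>. At a limit stage the residue of a level is fixed, so not being
  below \<open>(a, n)\<close> for arbitrarily large n means being at least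
  \<open>(Suc a, 0)\<close>.\<close>

lemma iter_levels_residue:
  assumes "\<mu> \<noteq> bot" "\<mu> \<le> sequentially"
  shows "iter_levels \<mu> {z. \<exists>m \<rho>. residue l z m \<rho>} a b
    = {z. \<exists>m \<rho>. residue l z m \<rho> \<and> \<not> ord_less \<rho> (a, b)}"
proof (induction a b rule: small_ordinal_induct)
  case zero
  show ?case by (auto simp: ord_less_def)
next
  case (Suc a b)
  note seq = filter_leD[OF assms(2)]
  have "(\<forall>\<^sub>F n in \<mu>. \<exists>m \<rho>. residue l (z + 3 ^ n) m \<rho> \<and> \<not> ord_less \<rho> (a, b)) \<longleftrightarrow>
     (\<exists>m \<rho>. residue l z m \<rho> \<and> \<not> ord_less \<rho> (a, Suc b))" (is "?L \<longleftrightarrow> ?R") for z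
  proof
    assume ?L
    moreover have "\<forall>\<^sub>F n in \<mu>. 2 * \<bar>z\<bar> < 3 ^ n"
    proof (rule seq, rule eventually_sequentiallyI)
      fix n assume "nat (2 * \<bar>z\<bar>) \<le> n"
      then have "2 * \<bar>z\<bar> \<le> int n" by simp
      also have "int n < int (3 ^ n)"
        unfolding of_nat_less_iff by (rule power_gt_expt) simp
      also have "\<dots> = 3 ^ n" by simp
      finally show "2 * \<bar>z\<bar> < 3 ^ n" .
    qed
    ultimately have "\<forall>\<^sub>F n in \<mu>. (\<exists>m \<rho>. residue l (z + 3 ^ n) m \<rho> \<and> \<not> ord_less \<rho> (a, b)) \<and> 2 * \<bar>z\<bar> < 3 ^ n"
      by (rule eventually_conj)
    then obtain n m \<rho> where n: "residue l (z + 3 ^ n) m \<rho>" "\<not> ord_less \<rho> (a, b)" "2 * \<bar>z\<bar> < 3 ^ n"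
      using eventually_happens'[OF assms(1)] by blast
    then obtain m' \<sigma> where \<sigma>: "residue l z m' \<sigma>" "descend \<sigma> n \<rho>"
      using residue_add_power[OF n(1,3)] by blast
    then have "\<not> ord_less \<sigma> (a, Suc b)"
      using descend_less[OF \<sigma>(2)] n(2) by (cases \<sigma>; cases \<rho>) (auto simp: ord_less_iff)
    with \<sigma>(1) show ?R by blast
  next
    assume ?R
    then obtain m c d where r: "residue l z m (c, d)" "\<not> ord_less (c, d) (a, Suc b)"
      by auto
    show ?L
    proof (rule seq, rule eventually_sequentiallyI)
      \<comment> \<open>The bound m makes n admissible as the next digit, and the bound b keeps
        \<open>(c', n)\<close> from falling below \<open>(a, b)\<close>.\<close>
      fix n assume n: "max m b \<le> n"
      show "\<exists>m \<rho>. residue l (z + 3 ^ n) m \<rho> \<and> \<not> ord_less \<rho> (a, b)"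
      proof (cases d)
        case 0
        then obtain c' where c': "c = Suc c'" "a \<le> c'"
          using r(2) by (cases c) (auto simp: ord_less_iff)
        have "residue l (z + 3 ^ n) (Suc n) (c', n)"
          using r(1) n unfolding 0 c'(1) by (auto intro: residue.step descend.intros)
        then show ?thesis using c'(2) n by (force simp: ord_less_iff)
      next
        case d': (Suc d')
        have "residue l (z + 3 ^ n) (Suc n) (c, d')"
          using r(1) n unfolding d' by (auto intro: residue.step descend.intros)
        then show ?thesis using r(2) d' by (force simp: ord_less_iff)
      qed
    qed
  qed
  then show ?case using Suc.IH by simp
next
  case (limit a)
  note seq = filter_leD[OF assms(2)]
  have "(\<forall>\<^sub>F n in \<mu>. \<exists>m \<rho>. residue l z m \<rho> \<and> \<not> ord_less \<rho> (a, n)) \<longleftrightarrow>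
     (\<exists>m \<rho>. residue l z m \<rho> \<and> \<not> ord_less \<rho> (Suc a, 0))" (is "?L \<longleftrightarrow> ?R") for z
  proof
    assume ?L
    then obtain m c d where r: "residue l z m (c, d)"
      using eventually_happens'[OF assms(1)] by force
    have "\<forall>\<^sub>F n in \<mu>. d < n"
      by (rule seq) (rule eventually_gt_at_top)
    with \<open>?L\<close> have "\<forall>\<^sub>F n in \<mu>. (\<exists>m \<rho>. residue l z m \<rho> \<and> \<not> ord_less \<rho> (a, n)) \<and> d < n"
      by (rule eventually_conj)
    \<comment> \<open>An index n > d rules out c = a, which leaves c > a.\<close>
    then obtain n where "\<not> ord_less (c, d) (a, n)" "d < n"
      using eventually_happens'[OF assms(1)] residue_unique[OF r] by blast
    with r show ?R by (force simp: ord_less_iff)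
  next
    assume ?R
    then obtain m c d where r: "residue l z m (c, d)" "\<not> ord_less (c, d) (Suc a, 0)"
      by auto
    then have "\<not> ord_less (c, d) (a, n)" for n by (auto simp: ord_less_iff)
    with r(1) show ?L by (intro always_eventually) blast
  qed
  then show ?case using limit.IH by simp
qed

text \<open>Residues never exceed l, and the level 0, at which no digit has been read, has residue l
  itself; it survives as long as any level does.\<close>

lemma iter_levels_residue_nonempty_iff:
  assumes "\<mu> \<noteq> bot" "\<mu> \<le> sequentially"
  shows "iter_levels \<mu> {z. \<exists>m \<rho>. residue l z m \<rho>} a b \<noteq> {} \<longleftrightarrow> \<not> ord_less l (a, b)"
proof -
  have "\<not> ord_less l (a, b)" if "residue l z m \<rho>" "\<not> ord_less \<rho> (a, b)" for z m \<rho>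
    using residue_le[OF that(1)] that(2) by (cases l; cases \<rho>) (auto simp: ord_less_iff)
  then show ?thesis
    unfolding iter_levels_residue[OF assms] using residue.start by blast
qed

section \<open>A real metric space with prescribed levels\<close>

text \<open>The absolute values in the sum only matter for negative parameters: a \<^const>\<open>Metric_space\<close>
  distance must be nonnegative outside the carrier too.\<close>

definition leg_dist :: "nat \<Rightarrow> real \<Rightarrow> nat \<Rightarrow> real \<Rightarrow> real" where
  "leg_dist i r j s = (if i = j then \<bar>r - s\<bar> else \<bar>r\<bar> + \<bar>s\<bar>)"

text \<open>\<open>None\<close> is the basepoint, and \<open>Some (t, z, i, r)\<close> is the point
  with parameter r on leg i of the star with t legs at level z. The pair t, z names the
  star.\<close>

fun sample_dist :: "(nat \<times> int \<times> nat \<times> real) option \<Rightarrow> (nat \<times> int \<times> nat \<times> real) option \<Rightarrow> real" where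
  "sample_dist None None = 0"
| "sample_dist None (Some (t, z, i, r)) = 2 powi z"
| "sample_dist (Some (t, z, i, r)) None = 2 powi z"
| "sample_dist (Some (t, z, i, r)) (Some (t', z', i', r')) =
    (if t = t' \<and> z = z' then 2 powi z * leg_dist i r i' r' / 4 else max (2 powi z) (2 powi z'))"

text \<open>The clause on \<open>r = 0\<close> gives the centre, which all legs share, a single
  code.\<close>

definition sample_space :: "(nat \<Rightarrow> int set) \<Rightarrow> (nat \<times> int \<times> nat \<times> real) option set" where
  "sample_space A = insert None
     {Some (t, z, i, r) |t z i r. z \<in> A t \<and> i < t \<and> 0 \<le> r \<and> r \<le> 1 \<and> (r = 0 \<longrightarrow> i = 0)}"

text \<open>Distances within a star are at most its height, and leaving the star costs at least its
  height, so a detour through the basepoint or another star is never a shortcut.\<close>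

lemma sample_dist_triangle:
  assumes "p \<in> sample_space A" "q \<in> sample_space A" "x \<in> sample_space A"
  shows "sample_dist p x \<le> sample_dist p q + sample_dist q x"
proof -
  have pos: "(0::real) < 2 powi z" for z :: int by (simp add: zero_less_power_int)
  have leg: "0 \<le> leg_dist i r j s" "leg_dist i r j s \<le> 2"
    if "0 \<le> r" "r \<le> 1" "0 \<le> s" "s \<le> 1" for i r j s
    using that by (auto simp: leg_dist_def)
  have scaled: "0 \<le> 2 powi z * leg_dist i r j s / 4" "2 powi z * leg_dist i r j s / 4 \<le> 2 powi z"
    if "0 \<le> r" "r \<le> 1" "0 \<le> s" "s \<le> 1" for z :: int and i r j s
    using leg[OF that, of i j] pos[of z] mult_left_mono[of "leg_dist i r j s" 2 "2 powi z"] by auto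
  have tri: "2 powi z * leg_dist i r k u / 4 \<le> 2 powi z * leg_dist i r j s / 4 + 2 powi z * leg_dist j s k u / 4"
    if "0 \<le> r" "0 \<le> s" "0 \<le> u" for z :: int and i r j s k u
  proof -
    have "leg_dist i r k u \<le> leg_dist i r j s + leg_dist j s k u"
      using that by (auto simp: leg_dist_def)
    from mult_left_mono[OF this, of "2 powi z"] pos[of z] show ?thesis
      by (simp add: distrib_left)
  qed
  have Some3: "sample_dist (Some (t1, z1, i1, r1)) (Some (t3, z3, i3, r3))
      \<le> sample_dist (Some (t1, z1, i1, r1)) (Some (t2, z2, i2, r2))
        + sample_dist (Some (t2, z2, i2, r2)) (Some (t3, z3, i3, r3))"
    if r: "0 \<le> r1" "r1 \<le> 1" "0 \<le> r2" "r2 \<le> 1" "0 \<le> r3" "r3 \<le> 1"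
    for t1 t2 t3 :: nat and z1 z2 z3 :: int and i1 i2 i3 :: nat and r1 r2 r3 :: real
  proof -
    note p1 = pos[of z1] and p2 = pos[of z2] and p3 = pos[of z3]
    note s12 = scaled[OF r(1-4), of z1 i1 i2] and s23 = scaled[OF r(3-6), of z2 i2 i3]
      and s13 = scaled[OF r(1,2,5,6), of z1 i1 i3]
    consider "t1 = t2 \<and> z1 = z2" "t2 = t3 \<and> z2 = z3"
      | "t1 = t2 \<and> z1 = z2" "\<not> (t2 = t3 \<and> z2 = z3)"
      | "\<not> (t1 = t2 \<and> z1 = z2)" "t2 = t3 \<and> z2 = z3"
      | "\<not> (t1 = t2 \<and> z1 = z2)" "\<not> (t2 = t3 \<and> z2 = z3)" "t1 = t3 \<and> z1 = z3"
      | "\<not> (t1 = t2 \<and> z1 = z2)" "\<not> (t2 = t3 \<and> z2 = z3)" "\<not> (t1 = t3 \<and> z1 = z3)"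
      by argo
    then show ?thesis
    proof cases
      case 1
      then show ?thesis using tri[OF r(1,3,5), of z1 i1 i3 i2] by simp
    next
      case 2
      then have "\<not> (t1 = t3 \<and> z1 = z3)" by auto
      then show ?thesis using 2 s12 by auto
    next
      case 3
      then have "\<not> (t1 = t3 \<and> z1 = z3)" by auto
      then show ?thesis using 3 s23 by auto
    next
      case 4
      have "2 powi z1 * leg_dist i1 r1 i3 r3 / 4 \<le> max (2 powi z1) (2 powi z2) + max (2 powi z2) (2 powi z3)"
        using s13 p1 p2 p3 by linarith
      then show ?thesis using 4 by auto
    next
      case 5
      have "max (2 powi z1) (2 powi z3) \<le> max (2 powi z1) (2 powi z2) + max (2 powi z2) ((2::real) powi z3)"
        using p1 p2 p3 by linarith
      then show ?thesis using 5 by auto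
    qed
  qed
  have base: "sample_dist None (Some (t, z, i, r))
      \<le> sample_dist None (Some (t', z', i', r')) + sample_dist (Some (t', z', i', r')) (Some (t, z, i, r))"
    "sample_dist (Some (t, z, i, r)) None
      \<le> sample_dist (Some (t, z, i, r)) (Some (t', z', i', r')) + sample_dist (Some (t', z', i', r')) None"
    "sample_dist (Some (t, z, i, r)) (Some (t', z', i', r'))
      \<le> sample_dist (Some (t, z, i, r)) None + sample_dist None (Some (t', z', i', r'))"
    if r: "0 \<le> r" "r \<le> 1" "0 \<le> r'" "r' \<le> 1" for t t' z z' i i' r r'
  proof -
    let ?p = "Some (t, z, i, r)" and ?q = "Some (t', z', i', r')"
    have d: "sample_dist ?p ?q \<le> 2 powi z + 2 powi z'" "2 powi z \<le> 2 powi z' + sample_dist ?q ?p"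
        "2 powi z \<le> sample_dist ?p ?q + 2 powi z'"
      if "t = t' \<and> z = z'"
      using that scaled[OF r, of z i i'] scaled[OF r(3,4,1,2), of z' i' i] pos[of z] by auto
    have d': "sample_dist ?p ?q \<le> 2 powi z + 2 powi z'" "2 powi z \<le> 2 powi z' + sample_dist ?q ?p"
        "2 powi z \<le> sample_dist ?p ?q + 2 powi z'"
      if "\<not> (t = t' \<and> z = z')"
    proof -
      have "sample_dist ?p ?q = max (2 powi z) (2 powi z')" "sample_dist ?q ?p = max (2 powi z') (2 powi z)"
        using that by auto
      then show "sample_dist ?p ?q \<le> 2 powi z + 2 powi z'" "2 powi z \<le> 2 powi z' + sample_dist ?q ?p"
        "2 powi z \<le> sample_dist ?p ?q + 2 powi z'"
        using pos[of z] pos[of z'] by linarith+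
    qed
    show "sample_dist None ?p \<le> sample_dist None ?q + sample_dist ?q ?p"
      "sample_dist ?p None \<le> sample_dist ?p ?q + sample_dist ?q None"
      "sample_dist ?p ?q \<le> sample_dist ?p None + sample_dist None ?q"
      using d d' by (cases "t = t' \<and> z = z'"; simp only: sample_dist.simps(1-3))+
  qed
  have point: "y = None \<or> (\<exists>t z i r. y = Some (t, z, i, r) \<and> 0 \<le> r \<and> r \<le> 1)"
    if "y \<in> sample_space A" for y
    using that unfolding sample_space_def by blast
  have degenerate: "sample_dist None y \<le> sample_dist None None + sample_dist None y"
    "sample_dist y None \<le> sample_dist y None + sample_dist None None"
    "sample_dist None None \<le> sample_dist None (Some w) + sample_dist (Some w) None" for y w
    using pos less_imp_le[OF pos] by (cases w; simp add: add_nonneg_nonneg)+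
  from point[OF assms(1)] show ?thesis
  proof (elim disjE exE conjE)
    assume p: "p = None"
    from point[OF assms(2)] point[OF assms(3)] show ?thesis
      unfolding p by (elim disjE exE conjE; hypsubst) (rule degenerate base; assumption)+
  next
    fix t z i r assume p: "p = Some (t, z, i, r)" and r: "0 \<le> r" "r \<le> 1"
    from point[OF assms(2)] point[OF assms(3)] r show ?thesis
      unfolding p by (elim disjE exE conjE; hypsubst) (rule degenerate base Some3; assumption)+
  qed
qed

lemma Metric_space_sample: "Metric_space (sample_space A) sample_dist"
proof
  have pos: "(0::real) < 2 powi z" for z :: int by (simp add: zero_less_power_int)
  have leg_commute: "leg_dist i r j s = leg_dist j s i r" for i r j s
    by (simp add: leg_dist_def abs_minus_commute)
  fix p q :: "(nat \<times> int \<times> nat \<times> real) option"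
  show "sample_dist p q = sample_dist q p"
  proof (cases "(p, q)" rule: sample_dist.cases)
    case (4 t z i r t' z' i' r')
    then have p: "p = Some (t, z, i, r)" and q: "q = Some (t', z', i', r')" by auto
    show ?thesis
      unfolding p q sample_dist.simps leg_commute[of i' r'] max.commute[of "2 powi z'"]
      by (intro if_cong) auto
  qed auto
  show "0 \<le> sample_dist p q"
  proof (cases "(p, q)" rule: sample_dist.cases)
    case (4 t z i r t' z' i' r')
    then have p: "p = Some (t, z, i, r)" and q: "q = Some (t', z', i', r')" by auto
    show ?thesis
      unfolding p q sample_dist.simps using pos[of z] pos[of z']
      by (auto simp: leg_dist_def le_max_iff_disj)
  qed auto
next
  have pos: "(2::real) powi z > 0" for z :: int by (simp add: zero_less_power_int)
  fix p q assume p: "p \<in> sample_space A" and q: "q \<in> sample_space A"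
  show "sample_dist p q = 0 \<longleftrightarrow> p = q"
  proof (cases "(p, q)" rule: sample_dist.cases)
    case (4 t z i r t' z' i' r')
    then have pq: "p = Some (t, z, i, r)" "q = Some (t', z', i', r')" by auto
    then have r: "0 \<le> r" "0 \<le> r'" "r = 0 \<longrightarrow> i = 0" "r' = 0 \<longrightarrow> i' = 0"
      using p q by (auto simp: sample_space_def)
    have "max (2 powi z) (2 powi z') \<noteq> (0::real)"
      using pos[of z] by (simp add: max_def)
    moreover have "leg_dist i r i' r' = 0 \<longleftrightarrow> i = i' \<and> r = r'"
      using r by (auto simp: leg_dist_def)
    moreover have "2 powi z * leg_dist i r i' r' / 4 = 0 \<longleftrightarrow> leg_dist i r i' r' = 0"
      using pos[of z] by simp
    ultimately show ?thesis
      unfolding pq sample_dist.simps by (cases "t = t' \<and> z = z'"; simp; blast)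
  qed (use pos in \<open>auto simp: less_imp_neq[symmetric]\<close>)
qed (fact sample_dist_triangle)

section \<open>The sample space as a space of hedgehogs\<close>

definition sample_curve :: "nat \<Rightarrow> int \<Rightarrow> nat \<Rightarrow> real \<Rightarrow> (nat \<times> int \<times> nat \<times> real) option" where
  "sample_curve t z i r = Some (t, z, if r = 0 then 0 else i, r)"

definition sample_curves :: "(nat \<Rightarrow> int set) \<Rightarrow> (real \<Rightarrow> (nat \<times> int \<times> nat \<times> real) option) set" where
  "sample_curves A = {sample_curve t z i |t z i. z \<in> A t \<and> i < t}"

abbreviation sample :: "(nat \<Rightarrow> int set) \<Rightarrow> (nat \<times> int \<times> nat \<times> real) option pointed_metric" where
  "sample A \<equiv> (metric (sample_space A, sample_dist), None)"

lemma mspace_sample: "mspace (pspace (sample A)) = sample_space A"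
  and mdist_sample: "mdist (pspace (sample A)) = sample_dist"
  using Metric_space_sample[of A] by (simp_all add: Metric_space.mspace_metric Metric_space.mdist_metric)

lemma height_sample: "height (sample A) (sample_curve t z i) = 2 powi z"
  by (simp only: height_def mdist_sample snd_conv) (simp add: sample_curve_def)

lemma hedgehogs_sample: "hedgehogs (sample A) (sample_curves A)"
proof -
  have space: "mspace (pspace (sample A))
      = insert (basept (sample A)) (\<Union>g\<in>sample_curves A. g ` {0..1})"
  proof (intro equalityI subsetI)
    fix p assume "p \<in> mspace (pspace (sample A))"
    then consider "p = None" | t z i r where "p = Some (t, z, i, r)" "z \<in> A t" "i < t"
        "0 \<le> r" "r \<le> 1" "r = 0 \<longrightarrow> i = 0"
      unfolding mspace_sample unfolding sample_space_def by blast
    then show "p \<in> insert (basept (sample A)) (\<Union>g\<in>sample_curves A. g ` {0..1})"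
    proof cases
      case (2 t z i r)
      then have "p = sample_curve t z i r" by (simp add: sample_curve_def)
      moreover have "sample_curve t z i \<in> sample_curves A"
        using 2 unfolding sample_curves_def by blast
      moreover have "r \<in> {0..1}" using 2 by simp
      ultimately show ?thesis by blast
    qed simp
  next
    fix p assume "p \<in> insert (basept (sample A)) (\<Union>g\<in>sample_curves A. g ` {0..1})"
    then show "p \<in> mspace (pspace (sample A))"
      unfolding mspace_sample by (auto simp: sample_space_def sample_curves_def sample_curve_def split: if_splits)
  qed
  have curveE: "\<exists>t z i. g = sample_curve t z i" if "g \<in> sample_curves A" for g
    using that unfolding sample_curves_def by blast
  have dist: "sample_dist (sample_curve t z i r) (sample_curve t' z' i' s) =
     (if sample_curve t z i 1 = sample_curve t' z' i' 1 then 2 powi z * \<bar>r - s\<bar> / 4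
      else if sample_curve t z i 0 = sample_curve t' z' i' 0 then 2 powi z * (r + s) / 4
      else max (2 powi z) (2 powi z'))"
    if "r \<in> {0..1}" "s \<in> {0..1}" for t t' z z' i i' r s
    using that by (simp add: sample_curve_def leg_dist_def)
  show ?thesis
    unfolding hedgehogs_def
  proof (intro conjI ballI space)
    fix g assume "g \<in> sample_curves A"
    then obtain t z i where "g = sample_curve t z i" using curveE by blast
    then show "\<exists>z::int. \<forall>r\<in>{0..1}. mdist (pspace (sample A)) (basept (sample A)) (g r) = 2 powi z"
      unfolding mdist_sample by (auto simp: sample_curve_def)
  next
    fix g g' and r s :: real
    assume "g \<in> sample_curves A" "g' \<in> sample_curves A" and rs: "r \<in> {0..1}" "s \<in> {0..1}"
    then obtain t z i t' z' i' where "g = sample_curve t z i" "g' = sample_curve t' z' i'"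
      using curveE by meson
    then show "mdist (pspace (sample A)) (g r) (g' s) =
        (if g 1 = g' 1 then height (sample A) g * \<bar>r - s\<bar> / 4
         else if g 0 = g' 0 then height (sample A) g * (r + s) / 4
         else max (height (sample A) g) (height (sample A) g'))"
      by (simp only: mdist_sample height_sample dist[OF rs])
  qed
qed

lemma levels_sample:
  assumes "0 < t"
  shows "levels (sample A) (sample_curves A) t = A t"
proof -
  have card: "card (tips (sample_curves A) (sample_curve t z i)) = t" if z: "z \<in> A t" for t z i
  proof -
    \<comment> \<open>The centre records t and z, so the legs that share it are exactly those of
      this star.\<close>
    have "tips (sample_curves A) (sample_curve t z i) = (\<lambda>j. Some (t, z, j, 1)) ` {..<t}"
    proof (intro equalityI subsetI)
      fix p assume "p \<in> tips (sample_curves A) (sample_curve t z i)"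
      then obtain t' z' j where "p = sample_curve t' z' j 1" "j < t'"
          "sample_curve t' z' j 0 = sample_curve t z i 0"
        unfolding tips_def sample_curves_def by blast
      then show "p \<in> (\<lambda>j. Some (t, z, j, 1)) ` {..<t}"
        by (simp add: sample_curve_def)
    next
      fix p :: "(nat \<times> int \<times> nat \<times> real) option"
      assume "p \<in> (\<lambda>j. Some (t, z, j, 1)) ` {..<t}"
      then obtain j where j: "j < t" "p = sample_curve t z j 1" by (auto simp: sample_curve_def)
      have "sample_curve t z j \<in> sample_curves A"
        using z j(1) unfolding sample_curves_def by blast
      then show "p \<in> tips (sample_curves A) (sample_curve t z i)"
        unfolding tips_def j(2) by (intro CollectI exI[of _ "sample_curve t z j"]) (simp add: sample_curve_def)
    qed
    then show ?thesis by (simp add: card_image inj_on_def)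
  qed
  show ?thesis
  proof (intro equalityI subsetI)
    fix z assume "z \<in> levels (sample A) (sample_curves A) t"
    then obtain t' z' i where "z' \<in> A t'" "height (sample A) (sample_curve t' z' i) = 2 powi z"
        "card (tips (sample_curves A) (sample_curve t' z' i)) = t"
      unfolding levels_def sample_curves_def by blast
    then show "z \<in> A t" by (simp add: card height_sample two_powi_eq_iff)
  next
    fix z assume z: "z \<in> A t"
    then have "sample_curve t z 0 \<in> sample_curves A"
      using assms unfolding sample_curves_def by blast
    then show "z \<in> levels (sample A) (sample_curves A) t"
      using card[OF z] height_sample unfolding levels_def by blast
  qed
qed

text \<open>An injection of the codes carries the metric along, so the carrier is a set of reals
  whose metric is unrelated to the usual one.\<close>

lemma real_hedgehogs_exist:
  fixes A :: "nat \<Rightarrow> int set"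
  shows "\<exists>(X :: real metric) e G. hedgehogs (X, e) G \<and> (\<forall>t>0. levels (X, e) G t = A t)"
proof -
  \<comment> \<open>a leg parameter lies in \<open>[0, 1]\<close>, so legs with different codes land in disjoint intervals\<close>
  define f :: "(nat \<times> int \<times> nat \<times> real) option \<Rightarrow> real" where
    "f = (\<lambda>p. case p of None \<Rightarrow> - 1 | Some (t, z, i, r) \<Rightarrow> 2 * real (to_nat (t, z, i)) + r)"
  have "inj_on f (sample_space A)"
  proof (rule inj_onI)
    fix p q assume pq: "p \<in> sample_space A" "q \<in> sample_space A" "f p = f q"
    \<comment> \<open>Points on legs are sent to nonnegative numbers, so -1 is free for the
      basepoint.\<close>
    have neq: "2 * real m + r \<noteq> - 1" if "0 \<le> r" for m r using that by simp
    have eq: "m = n \<and> r = s"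
      if "2 * real m + r = 2 * real n + s" "0 \<le> r" "r \<le> 1" "0 \<le> s" "s \<le> 1" for m n r s
    proof -
      have "real m < real n + 1" "real n < real m + 1" using that by linarith+
      then have "m = n" by linarith
      with that show ?thesis by simp
    qed
    show "p = q"
    proof (cases "p = None \<or> q = None")
      case True
      then show ?thesis using pq neq neq[symmetric] unfolding f_def sample_space_def by auto
    next
      case False
      then obtain t z i r t' z' i' r' where p: "p = Some (t, z, i, r)" "0 \<le> r" "r \<le> 1"
          and q: "q = Some (t', z', i', r')" "0 \<le> r'" "r' \<le> 1"
        using pq(1,2) unfolding sample_space_def by blast
      then have "to_nat (t, z, i) = to_nat (t', z', i') \<and> r = r'"
        using pq(3) by (intro eq) (simp_all add: f_def)
      then show ?thesis using p(1) q(1) by simp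
    qed
  qed
  then have "inj_on f (mspace (pspace (sample A)))" unfolding mspace_sample .
  note T = hedgehogs_transport[OF hedgehogs_sample this]
  show ?thesis
    using T(1) levels_sample[of _ A] unfolding T(2)[symmetric]
    by (metis prod.collapse)
qed

section \<open>Distinguishing the iterated cones\<close>

theorem theorem4p9:
  fixes k :: nat
  assumes "k \<ge> 1"
  shows "\<exists>(X :: real metric) e \<alpha>. e \<in> mspace X \<and> scaling_factor \<alpha> \<and>
    (\<forall>\<mu>. ultrafilter \<mu> \<and> nonprincipal \<mu> \<longrightarrow>
      (\<forall>\<xi> \<eta>. ord_less \<xi> (omega_times k) \<and> ord_less \<eta> (omega_times k) \<and> \<xi> \<noteq> \<eta> \<longrightarrow>
        \<not> mtopology_of (Cone \<mu> \<xi> X e \<alpha>) homeomorphic_space mtopology_of (Cone \<mu> \<eta> X e \<alpha>)))"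
proof -
  \<comment> \<open>The numbering \<open>to_nat\<close> gives every ordinal its own number of legs,
    and adding 3 makes this number recognisable by \<open>noncut_counts_hedgehogs\<close>.\<close>
  define legs :: "small_ordinal \<Rightarrow> nat" where "legs l = to_nat l + 3" for l
  \<comment> \<open>For t < 3 the truncated subtraction yields the levels of
    \<open>from_nat 0\<close>; this is harmless, as \<open>legs l\<close> is always at least
    3.\<close>
  let ?A = "\<lambda>t. {z. \<exists>m \<rho>. residue (from_nat (t - 3)) z m \<rho>}"
  obtain X :: "real metric" and e G where H: "hedgehogs (X, e) G"
      and lev: "\<And>t. 0 < t \<Longrightarrow> levels (X, e) G t = ?A t"
    using real_hedgehogs_exist[of ?A] by blast
  have "filterlim (\<lambda>m. 2 ^ 3 ^ m :: real) at_top sequentially"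
  proof (rule filterlim_at_top_mono)
    show "filterlim (\<lambda>m. real m) at_top sequentially" by (rule filterlim_real_sequentially)
    have "real m \<le> 2 ^ 3 ^ m" for m
    proof -
      have "m < 3 ^ m" by (rule power_gt_expt) simp
      also have "(3::nat) ^ m < 2 ^ 3 ^ m" by (rule less_exp)
      finally have "real m < real (2 ^ 3 ^ m)" unfolding of_nat_less_iff .
      then show ?thesis by simp
    qed
    then show "\<forall>\<^sub>F m in sequentially. real m \<le> 2 ^ 3 ^ m" by simp
  qed
  then have scaling: "scaling_factor (\<lambda>m. 2 ^ 3 ^ m)"
    by (simp add: scaling_factor_def)
  have detect: "legs l \<in> noncut_counts (mtopology_of (Cone \<mu> \<xi> X e (\<lambda>m. 2 ^ 3 ^ m))) \<longleftrightarrow> \<not> ord_less l \<xi>"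
    if \<mu>: "ultrafilter \<mu>" "nonprincipal \<mu>" for \<mu> l \<xi>
  proof -
    obtain a b where \<xi>: "\<xi> = (a, b)" by (cases \<xi>)
    obtain G' where G': "hedgehogs (iter_cone \<mu> (\<lambda>m. 2 ^ 3 ^ m) (X, e) a b) G'"
        "\<And>t. 0 < t \<Longrightarrow> levels (iter_cone \<mu> (\<lambda>m. 2 ^ 3 ^ m) (X, e) a b) G' t
          = iter_levels \<mu> (levels (X, e) G t) a b"
      using hedgehogs_iter_cone[OF \<mu>(1) H] by blast
    have "levels (X, e) G (legs l) = {z. \<exists>m \<rho>. residue l z m \<rho>}"
      by (simp add: lev legs_def)
    then have "levels (iter_cone \<mu> (\<lambda>m. 2 ^ 3 ^ m) (X, e) a b) G' (legs l) \<noteq> {} \<longleftrightarrow> \<not> ord_less l \<xi>"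
      using G'(2)[of "legs l"] iter_levels_residue_nonempty_iff[of \<mu> l a b]
        nonprincipal_le_sequentially[OF \<mu>] \<mu>(1)
      by (simp add: legs_def \<xi> ultrafilter_def)
    then show ?thesis
      using noncut_counts_hedgehogs[OF G'(1), of "legs l"]
      by (simp add: Cone_def \<xi> legs_def)
  qed
  have "\<not> mtopology_of (Cone \<mu> \<xi> X e (\<lambda>m. 2 ^ 3 ^ m)) homeomorphic_space
        mtopology_of (Cone \<mu> \<eta> X e (\<lambda>m. 2 ^ 3 ^ m))"
    if \<mu>: "ultrafilter \<mu>" "nonprincipal \<mu>" and "\<xi> \<noteq> \<eta>" for \<mu> \<xi> \<eta>
  proof
    assume "mtopology_of (Cone \<mu> \<xi> X e (\<lambda>m. 2 ^ 3 ^ m)) homeomorphic_space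
        mtopology_of (Cone \<mu> \<eta> X e (\<lambda>m. 2 ^ 3 ^ m))"
    then have "\<not> ord_less l \<xi> \<longleftrightarrow> \<not> ord_less l \<eta>" for l
      using detect[OF \<mu>] noncut_counts_homeomorphic by metis
    \<comment> \<open>The stars of \<xi> occur in the cone at \<xi>, hence in the one at \<eta>,
      which gives \<eta> \<le> \<xi>; exchanging the roles gives equality.\<close>
    from this[of \<xi>] this[of \<eta>] \<open>\<xi> \<noteq> \<eta>\<close> show False
      by (cases \<xi>; cases \<eta>) (auto simp: ord_less_iff)
  qed
  moreover have "e \<in> mspace X"
    using hedgehogs_pointed[OF H] by (simp add: pointed_def)
  ultimately show ?thesis
    using scaling by blast
qed

end
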